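(* Let $u\in W_2^6[a,b]$ be the exact solution of $$u^{(5)}(x)=f(x)u(x)+g(x),\quad x\in[a,b],\qquad u(a)=u'(a)=u''(a)=u(b)=u'(b)=0,$$ i.e. $Lu=g$. Then $$u(x)=\sum_{i=1}^{\infty}\sum_{k=1}^{i}\beta_{ik}\,g(x_k)\,\overline{\Psi}_i(x),$$ where $\{x_i\}_{i=1}^\infty$ is a dense set in $[a,b]$, the outer series converging in $W_2^6[a,b]$.
   Context: All functions are real-valued, $a<b$. $W_2^6[a,b]$ is the Hilbert space of functions $u$ on $[a,b]$ such that $u,u',\dots,u^{(5)}$ are absolutely continuous, $u^{(6)}\in L^2[a,b]$, and $u(a)=u'(a)=u''(a)=u(b)=u'(b)=0$, with inner product $\langle u,v\rangle_{W_2^6}=\sum_{i=0}^5u^{(i)}(a)v^{(i)}(a)+\int_a^bu^{(6)}v^{(6)}\,dx$. $W_2^1[a,b]$ is the Hilbert space of absolutely continuous functions $u$ on $[a,b]$ with $u'\in L^2[a,b]$, with inner product $\langle u,v\rangle_{W_2^1}=u(a)v(a)+\int_a^bu'v'\,dx$. It is a reproducing kernel Hilbert space; $T_x\in W_2^1[a,b]$ denotes its reproducing kernel function at $x$, i.e. $\langle v,T_x\rangle_{W_2^1}=v(x)$ for all $v\in W_2^1[a,b]$. $f$ is absolutely continuous on $[a,b]$ with $f'\in L^2[a,b]$, $g$ is continuous on $[a,b]$, and $L:W_2^6[a,b]\to W_2^1[a,b]$ is the bounded linear operator $Lu=u^{(5)}-fu$. It is assumed that $L$ is invertible (equivalently,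 the boundary-value problem is uniquely solvable). $L^*:W_2^1[a,b]\to W_2^6[a,b]$ is the Hilbert space adjoint of $L$. $\{x_i\}_{i=1}^\infty$ is a sequence of distinct points dense in $[a,b]$, and $\Psi_i=L^*T_{x_i}\in W_2^6[a,b]$. The system $\{\overline\Psi_i\}_{i=1}^\infty$ is the orthonormal system in $W_2^6[a,b]$ obtained from $\{\Psi_i\}_{i=1}^\infty$ by Gram–Schmidt orthonormalization: $\overline\Psi_i=\sum_{k=1}^i\beta_{ik}\Psi_k$ with $\beta_{ii}>0$. *)

theory Defs
  imports "HOL-Analysis.Analysis"
begin

text \<open>
  A function on \<open>[a,b]\<close> is represented by its extension by \<open>0\<close> to the real line.
  Thus members of the spaces below are equal as soon as they agree on \<open>[a,b]\<close>, and the
  spaces are closed under pointwise addition and scaling.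
\<close>

definition zero_outside :: "real \<Rightarrow> real \<Rightarrow> (real \<Rightarrow> real) \<Rightarrow> bool" where
  "zero_outside a b u \<longleftrightarrow> (\<forall>x. x \<notin> {a..b} \<longrightarrow> u x = 0)"

text \<open>The derivatives are one-sided at the endpoints.\<close>

definition deriv_Icc :: "real \<Rightarrow> real \<Rightarrow> nat \<Rightarrow> (real \<Rightarrow> real) \<Rightarrow> real \<Rightarrow> real" where
  "deriv_Icc a b i u =
     ((\<lambda>h x. if x \<in> {a..b} then vector_derivative h (at x within {a..b}) else 0) ^^ i) u"

text \<open>
  The usual \<open>\<epsilon>\<close>-\<open>\<delta>\<close> definition: a division is a finite family of closed
  intervals with pairwise disjoint interiors.
\<close>

definition abs_cont_Icc :: "real \<Rightarrow> real \<Rightarrow> (real \<Rightarrow> real) \<Rightarrow> bool" where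
  "abs_cont_Icc a b u \<longleftrightarrow>
     (\<forall>\<epsilon>>0. \<exists>\<delta>>0. \<forall>\<D> S. \<D> division_of S \<and> S \<subseteq> {a..b} \<and> (\<Sum>K\<in>\<D>. Sup K - Inf K) < \<delta>
        \<longrightarrow> (\<Sum>K\<in>\<D>. \<bar>u (Sup K) - u (Inf K)\<bar>) < \<epsilon>)"

text \<open>
  The derivative of an absolutely continuous function need exist only almost everywhere; the
  value of \<^const>\<open>deriv_Icc\<close> on the exceptional null set is irrelevant here and in the
  inner products.
\<close>

definition deriv_in_L2 :: "real \<Rightarrow> real \<Rightarrow> (real \<Rightarrow> real) \<Rightarrow> bool" where
  "deriv_in_L2 a b u \<longleftrightarrow>
     (AE x in lebesgue. x \<in> {a..b} \<longrightarrow> u differentiable (at x within {a..b})) \<and>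
     set_borel_measurable lebesgue {a..b} (deriv_Icc a b 1 u) \<and>
     set_integrable lebesgue {a..b} (\<lambda>x. (deriv_Icc a b 1 u x)\<^sup>2)"

definition W26 :: "real \<Rightarrow> real \<Rightarrow> (real \<Rightarrow> real) set" where
  "W26 a b = {u. zero_outside a b u \<and>
     (\<forall>i<5. deriv_Icc a b i u differentiable_on {a..b}) \<and>
     (\<forall>i\<le>5. abs_cont_Icc a b (deriv_Icc a b i u)) \<and>
     deriv_in_L2 a b (deriv_Icc a b 5 u) \<and>
     u a = 0 \<and> deriv_Icc a b 1 u a = 0 \<and> deriv_Icc a b 2 u a = 0 \<and>
     u b = 0 \<and> deriv_Icc a b 1 u b = 0}"

definition inner_W26 :: "real \<Rightarrow> real \<Rightarrow> (real \<Rightarrow> real) \<Rightarrow> (real \<Rightarrow> real) \<Rightarrow> real" where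
  "inner_W26 a b u v =
     (\<Sum>i\<le>5. deriv_Icc a b i u a * deriv_Icc a b i v a) +
     (LINT x:{a..b}|lebesgue. deriv_Icc a b 6 u x * deriv_Icc a b 6 v x)"

definition norm_W26 :: "real \<Rightarrow> real \<Rightarrow> (real \<Rightarrow> real) \<Rightarrow> real" where
  "norm_W26 a b u = sqrt (inner_W26 a b u u)"

definition W21 :: "real \<Rightarrow> real \<Rightarrow> (real \<Rightarrow> real) set" where
  "W21 a b = {u. zero_outside a b u \<and> abs_cont_Icc a b u \<and> deriv_in_L2 a b u}"

definition inner_W21 :: "real \<Rightarrow> real \<Rightarrow> (real \<Rightarrow> real) \<Rightarrow> (real \<Rightarrow> real) \<Rightarrow> real" where
  "inner_W21 a b u v =
     u a * v a + (LINT x:{a..b}|lebesgue. deriv_Icc a b 1 u x * deriv_Icc a b 1 v x)"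

definition op_L :: "real \<Rightarrow> real \<Rightarrow> (real \<Rightarrow> real) \<Rightarrow> (real \<Rightarrow> real) \<Rightarrow> real \<Rightarrow> real" where
  "op_L a b f u = (\<lambda>x. if x \<in> {a..b} then deriv_Icc a b 5 u x - f x * u x else 0)"

definition is_reproducing_kernel ::
    "('p \<Rightarrow> real) set \<Rightarrow> (('p \<Rightarrow> real) \<Rightarrow> ('p \<Rightarrow> real) \<Rightarrow> real) \<Rightarrow> 'p set \<Rightarrow> ('p \<Rightarrow> 'p \<Rightarrow> real) \<Rightarrow> bool"
  where
  "is_reproducing_kernel H ip X T \<longleftrightarrow> (\<forall>x\<in>X. T x \<in> H \<and> (\<forall>v\<in>H. ip v (T x) = v x))"

definition is_adjoint ::
    "'h set \<Rightarrow> ('h \<Rightarrow> 'h \<Rightarrow> real) \<Rightarrow> 'k set \<Rightarrow> ('k \<Rightarrow> 'k \<Rightarrow> real) \<Rightarrow> ('h \<Rightarrow> 'k) \<Rightarrow> ('k \<Rightarrow> 'h) \<Rightarrow> bool"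
  where
  "is_adjoint H ipH K ipK A B \<longleftrightarrow>
     (\<forall>v\<in>K. B v \<in> H) \<and> (\<forall>u\<in>H. \<forall>v\<in>K. ipK (A u) v = ipH u (B v))"

fun gram_schmidt ::
    "(('p \<Rightarrow> real) \<Rightarrow> ('p \<Rightarrow> real) \<Rightarrow> real) \<Rightarrow> (nat \<Rightarrow> 'p \<Rightarrow> real) \<Rightarrow> nat \<Rightarrow> 'p \<Rightarrow> real" where
  "gram_schmidt ip \<psi> n =
     (let r = (\<lambda>t. \<psi> n t - (\<Sum>k<n. ip (\<psi> n) (gram_schmidt ip \<psi> k) * gram_schmidt ip \<psi> k t))
      in (\<lambda>t. r t / sqrt (ip r r)))"

declare gram_schmidt.simps [simp del]

end

(* The remainders r_n of the Fourier expansion of u are Cauchy in W26, so their derivatives up to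
   order five converge uniformly.  Since r_n is orthogonal to Psi_k for k < n, and
   <v, Psi_k> = (L v)(x_k), the limit r satisfies L r = 0 on the dense set of the x_k, hence
   everywhere; the equation r^(5) = f r shows that r is in W26 (so completeness of L^2 is not
   invoked), and injectivity of L gives r = 0.
   The sixth derivatives tend to 0 in L^2 because, by Fatou's lemma, the L^2 norm of a derivative
   F' is controlled by the difference quotients of F over uniform grids, where only the uniform
   convergence of the fifth derivatives and the Cauchy property enter. *)

theory Submission
  imports Defs
begin

text \<open>The series is a Fourier series in disguise: \<open>\<Psi>bar i\<close> is a combination
  of the \<open>\<Psi> k\<close>, and <u, \<Psi> k> = (L u)(x k) = g (x k), so its coefficients are
  the inner products of u with the \<open>\<Psi>bar i\<close>. Remainders are Cauchy since a
  difference of two of them is orthogonal to the later one, so squared distances are differences of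
  a decreasing sequence. The obstacle is the top order: smallness of the fifth derivatives says
  nothing about the L^2 size of the sixth. It is met by comparing the integral of F'^2 with the
  energies of the piecewise linear interpolants of F: each energy is at most the integral
  (Cauchy-Schwarz on every cell), and the integral is at most any common bound of the energies. An
  energy sees F at finitely many points only, so on a fixed grid n can go to infinity in R m - R n;
  varying the grid afterwards bounds the sixth derivative of R m itself. The first comparison rests
  on the fundamental theorem of calculus for the epsilon-delta form of absolute continuity.\<close>

section \<open>Gram--Schmidt in a semi-inner product space of functions\<close>

text \<open>Definiteness is left out because one of the two instances, square integrable functions
  with the L^2 pairing, contains nonzero functions that vanish almost everywhere. Merging addition
  and scaling into \<open>u + c * v\<close> leaves one closure and one linearity check per
  instance.\<close>

locale semi_inner_product =
  fixes V :: "('p \<Rightarrow> real) set" and ip :: "('p \<Rightarrow> real) \<Rightarrow> ('p \<Rightarrow> real) \<Rightarrow> real"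
  assumes zero_mem: "(\<lambda>t. 0) \<in> V"
    and add_scale_mem: "u \<in> V \<Longrightarrow> v \<in> V \<Longrightarrow> (\<lambda>t. u t + c * v t) \<in> V"
    and add_scale_left: "u \<in> V \<Longrightarrow> v \<in> V \<Longrightarrow> w \<in> V \<Longrightarrow>
      ip (\<lambda>t. u t + c * v t) w = ip u w + c * ip v w"
    and commute: "u \<in> V \<Longrightarrow> v \<in> V \<Longrightarrow> ip u v = ip v u"
    and nonneg: "u \<in> V \<Longrightarrow> 0 \<le> ip u u"
begin

lemma add_scale_right:
  "u \<in> V \<Longrightarrow> v \<in> V \<Longrightarrow> w \<in> V \<Longrightarrow> ip w (\<lambda>t. u t + c * v t) = ip w u + c * ip w v"
  by (simp only: commute[of w] add_scale_mem add_scale_left)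

lemma zero_left: "w \<in> V \<Longrightarrow> ip (\<lambda>t. 0) w = 0"
  using add_scale_left[of "\<lambda>t. 0" "\<lambda>t. 0" w 1] by (simp add: zero_mem)

lemma scale_mem: "u \<in> V \<Longrightarrow> (\<lambda>t. c * u t) \<in> V"
  using add_scale_mem[of "\<lambda>t. 0" u c] by (simp add: zero_mem)

lemma scale_left: "u \<in> V \<Longrightarrow> w \<in> V \<Longrightarrow> ip (\<lambda>t. c * u t) w = c * ip u w"
  using add_scale_left[of "\<lambda>t. 0" u w c] by (simp add: zero_mem zero_left)

lemma scale_right: "u \<in> V \<Longrightarrow> w \<in> V \<Longrightarrow> ip w (\<lambda>t. c * u t) = c * ip w u"
  by (simp only: commute[of w] scale_mem scale_left)

lemma diff_mem: "u \<in> V \<Longrightarrow> v \<in> V \<Longrightarrow> (\<lambda>t. u t - v t) \<in> V"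
  using add_scale_mem[of u v "-1"] by simp

lemma diff_left: "u \<in> V \<Longrightarrow> v \<in> V \<Longrightarrow> w \<in> V \<Longrightarrow> ip (\<lambda>t. u t - v t) w = ip u w - ip v w"
  using add_scale_left[of u v w "-1"] by simp

lemma diff_right: "u \<in> V \<Longrightarrow> v \<in> V \<Longrightarrow> w \<in> V \<Longrightarrow> ip w (\<lambda>t. u t - v t) = ip w u - ip w v"
  using add_scale_right[of u v w "-1"] by simp

lemma sum_mem:
  assumes "finite I" "\<And>i. i \<in> I \<Longrightarrow> e i \<in> V"
  shows "(\<lambda>t. \<Sum>i\<in>I. c i * e i t) \<in> V"
  using assms
proof (induction I rule: finite_induct)
  case empty
  then show ?case by (simp add: zero_mem)
next
  case (insert i I)
  then have "(\<lambda>t. (\<Sum>i\<in>I. c i * e i t) + c i * e i t) \<in> V"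
    by (intro add_scale_mem) auto
  then show ?case using insert by (simp add: add.commute)
qed

lemma sum_left:
  assumes "finite I" "\<And>i. i \<in> I \<Longrightarrow> e i \<in> V" "w \<in> V"
  shows "ip (\<lambda>t. \<Sum>i\<in>I. c i * e i t) w = (\<Sum>i\<in>I. c i * ip (e i) w)"
  using assms
proof (induction I rule: finite_induct)
  case empty
  then show ?case by (simp add: zero_left)
next
  case (insert i I)
  then have "ip (\<lambda>t. (\<Sum>i\<in>I. c i * e i t) + c i * e i t) w = ip (\<lambda>t. \<Sum>i\<in>I. c i * e i t) w + c i * ip (e i) w"
    by (intro add_scale_left sum_mem) auto
  then show ?case using insert by (simp add: add.commute)
qed

lemma sum_right:
  assumes "finite I" "\<And>i. i \<in> I \<Longrightarrow> e i \<in> V" "w \<in> V"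
  shows "ip w (\<lambda>t. \<Sum>i\<in>I. c i * e i t) = (\<Sum>i\<in>I. c i * ip w (e i))"
proof -
  have "ip w (\<lambda>t. \<Sum>i\<in>I. c i * e i t) = (\<Sum>i\<in>I. c i * ip (e i) w)"
    by (simp only: commute[OF assms(3) sum_mem[OF assms(1,2)]] sum_left[OF assms])
  also have "\<dots> = (\<Sum>i\<in>I. c i * ip w (e i))"
    using commute[OF assms(2,3)] by (intro sum.cong refl) simp
  finally show ?thesis .
qed

lemma Cauchy_Schwarz:
  assumes "u \<in> V" "v \<in> V"
  shows "(ip u v)\<^sup>2 \<le> ip u u * ip v v"
proof -
  have q: "0 \<le> ip u u + 2 * c * ip u v + c\<^sup>2 * ip v v" for c
  proof -
    have "ip (\<lambda>t. u t + c * v t) (\<lambda>t. u t + c * v t) = ip u u + c * ip u v + c * (ip v u + c * ip v v)"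
      by (simp add: add_scale_left add_scale_right add_scale_mem assms)
    then show ?thesis
      using nonneg[OF add_scale_mem[OF assms, of c]] commute[OF assms]
      by (simp add: power2_eq_square algebra_simps)
  qed
  show ?thesis
  proof (cases "ip v v = 0")
    case True
    have "ip u v = 0"
    proof (rule ccontr)
      assume "ip u v \<noteq> 0"
      then show False
        \<comment> \<open>With \<open>ip v v = 0\<close> the expression in \<open>q\<close> is
          affine in \<open>c\<close>, and this \<open>c\<close> gives it the value -1.\<close>
        using q[of "- (ip u u + 1) / (2 * ip u v)"] True by (simp add: field_simps)
    qed
    then show ?thesis using True by simp
  next
    case False
    then have "0 < ip v v" using nonneg[OF assms(2)] by simp
    moreover have "ip u u - (ip u v)\<^sup>2 / ip v v \<ge> 0"
      using q[of "- ip u v / ip v v"] False by (simp add: field_simps power2_eq_square)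
    ultimately show ?thesis by (simp add: field_simps)
  qed
qed

lemma null_right: "u \<in> V \<Longrightarrow> v \<in> V \<Longrightarrow> ip v v = 0 \<Longrightarrow> ip u v = 0"
  using Cauchy_Schwarz[of u v] by simp

definition gs_residual :: "(nat \<Rightarrow> 'p \<Rightarrow> real) \<Rightarrow> nat \<Rightarrow> 'p \<Rightarrow> real" where
  "gs_residual \<psi> n =
     (\<lambda>t. \<psi> n t - (\<Sum>k<n. ip (\<psi> n) (gram_schmidt ip \<psi> k) * gram_schmidt ip \<psi> k t))"

lemma gram_schmidt_eq:
  "gram_schmidt ip \<psi> n
     = (\<lambda>t. 1 / sqrt (ip (gs_residual \<psi> n) (gs_residual \<psi> n)) * gs_residual \<psi> n t)"
  by (subst gram_schmidt.simps) (simp add: gs_residual_def Let_def)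

definition fourier_remainder ::
    "(nat \<Rightarrow> 'p \<Rightarrow> real) \<Rightarrow> ('p \<Rightarrow> real) \<Rightarrow> nat \<Rightarrow> 'p \<Rightarrow> real" where
  "fourier_remainder \<psi> v n =
     (\<lambda>t. v t - (\<Sum>i<n. ip v (gram_schmidt ip \<psi> i) * gram_schmidt ip \<psi> i t))"

section \<open>Gram-Schmidt families and Fourier remainders\<close>

context
  fixes \<psi> :: "nat \<Rightarrow> 'p \<Rightarrow> real"
  assumes \<psi>: "\<And>n. \<psi> n \<in> V"
begin

abbreviation "e \<equiv> gram_schmidt ip \<psi>"

lemma gram_schmidt_mem: "e n \<in> V"
proof (induction n rule: less_induct)
  case (less n)
  then have "gs_residual \<psi> n \<in> V"
    unfolding gs_residual_def by (intro diff_mem sum_mem \<psi>) auto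
  then show ?case
    unfolding gram_schmidt_eq by (rule scale_mem)
qed

lemma gs_residual_mem: "gs_residual \<psi> n \<in> V"
  unfolding gs_residual_def by (intro diff_mem sum_mem \<psi> gram_schmidt_mem) auto

text \<open>When the residual is a null vector, division by zero makes \<open>e n\<close> the zero function: for
  arbitrary \<open>\<psi>\<close> the family is orthonormal only up to some members being zero, whence the form of
  the next statement.\<close>

lemma gram_schmidt_norm:
  assumes "v \<in> V"
  shows "ip v (e n) * ip (e n) (e n) = ip v (e n)"
proof -
  let ?r = "gs_residual \<psi> n"
  let ?s = "1 / sqrt (ip ?r ?r)"
  have e: "e n = (\<lambda>t. ?s * ?r t)" by (rule gram_schmidt_eq)
  have "ip (e n) (e n) = ?s * ip ?r (\<lambda>t. ?s * ?r t)"
    unfolding e by (rule scale_left[OF gs_residual_mem scale_mem[OF gs_residual_mem]])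
  also have "ip ?r (\<lambda>t. ?s * ?r t) = ip (\<lambda>t. ?s * ?r t) ?r"
    by (rule commute[OF gs_residual_mem scale_mem[OF gs_residual_mem]])
  also have "\<dots> = ?s * ip ?r ?r"
    by (rule scale_left[OF gs_residual_mem gs_residual_mem])
  finally have ee: "ip (e n) (e n) = ?s * (?s * ip ?r ?r)" .
  show ?thesis
  proof (cases "ip ?r ?r = 0")
    case True
    then show ?thesis using null_right[OF assms gram_schmidt_mem] ee by simp
  next
    case False
    moreover have "ip ?r ?r \<ge> 0"
      by (rule nonneg[OF gs_residual_mem])
    ultimately have "ip (e n) (e n) = 1"
      unfolding ee by (simp add: real_div_sqrt)
    then show ?thesis by simp
  qed
qed

text \<open>Strong induction on the larger index; symmetry of the form covers the other
  order.\<close>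

lemma gram_schmidt_orthogonal: "j \<noteq> k \<Longrightarrow> ip (e j) (e k) = 0"
proof -
  have "\<forall>k<n. ip (e n) (e k) = 0" for n
  proof (induction n rule: less_induct)
    case (less n)
    have orth: "ip (e i) (e k) = 0" if "i < n" "k < n" "i \<noteq> k" for i k
      using that less commute[OF gram_schmidt_mem[of i] gram_schmidt_mem[of k]]
      by (cases "i < k") auto
    show ?case
    proof (intro allI impI)
      fix k assume "k < n"
      have "ip (gs_residual \<psi> n) (e k)
          = ip (\<psi> n) (e k) - (\<Sum>i<n. ip (\<psi> n) (e i) * ip (e i) (e k))"
        unfolding gs_residual_def
        by (simp add: diff_left sum_left sum_mem \<psi> gram_schmidt_mem)
      \<comment> \<open>The surviving term carries the factor \<open>ip (e k) (e k)\<close>, which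
        is 1 or 0; \<open>gram_schmidt_norm\<close> absorbs it in both cases.\<close>
      also have "(\<Sum>i<n. ip (\<psi> n) (e i) * ip (e i) (e k)) = (\<Sum>i\<in>{k}. ip (\<psi> n) (e i) * ip (e i) (e k))"
        using \<open>k < n\<close> orth by (intro sum.mono_neutral_right) auto
      finally have "ip (gs_residual \<psi> n) (e k) = 0"
        by (simp add: gram_schmidt_norm \<psi>)
      then show "ip (e n) (e k) = 0"
        using scale_left[OF gs_residual_mem gram_schmidt_mem] by (simp only: gram_schmidt_eq[of _ n] mult_zero_right)
    qed
  qed
  then show "j \<noteq> k \<Longrightarrow> ip (e j) (e k) = 0"
    using commute[OF gram_schmidt_mem[of j] gram_schmidt_mem[of k]] by (cases "j < k") auto
qed

lemma fourier_remainder_mem: "v \<in> V \<Longrightarrow> fourier_remainder \<psi> v n \<in> V"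
  unfolding fourier_remainder_def by (intro diff_mem sum_mem gram_schmidt_mem) auto

lemma fourier_remainder_orthogonal:
  assumes "v \<in> V" "k < n"
  shows "ip (fourier_remainder \<psi> v n) (e k) = 0"
proof -
  have "ip (fourier_remainder \<psi> v n) (e k) = ip v (e k) - (\<Sum>i<n. ip v (e i) * ip (e i) (e k))"
    unfolding fourier_remainder_def
    by (simp add: diff_left sum_left sum_mem assms gram_schmidt_mem)
  also have "(\<Sum>i<n. ip v (e i) * ip (e i) (e k)) = (\<Sum>i\<in>{k}. ip v (e i) * ip (e i) (e k))"
    using assms gram_schmidt_orthogonal by (intro sum.mono_neutral_right) auto
  finally show ?thesis
    by (simp add: gram_schmidt_norm assms)
qed

text \<open>\<open>\<psi> k\<close> differs from its residual by a combination of earlier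
  \<open>e i\<close>, to which the remainder is orthogonal. The residual is a multiple of
  \<open>e k\<close> unless it is a null vector, and null vectors are orthogonal to everything by
  Cauchy-Schwarz. This is the form in which orthogonality becomes a statement about L at the
  nodes.\<close>

lemma fourier_remainder_orthogonal_generator:
  assumes "v \<in> V" "k < n"
  shows "ip (fourier_remainder \<psi> v n) (\<psi> k) = 0"
proof -
  let ?w = "fourier_remainder \<psi> v n"
  let ?r = "gs_residual \<psi> k"
  have w: "?w \<in> V" by (rule fourier_remainder_mem[OF assms(1)])
  have "ip ?w ?r = ip ?w (\<psi> k) - (\<Sum>i<k. ip (\<psi> k) (e i) * ip ?w (e i))"
    unfolding gs_residual_def
    by (simp add: diff_right sum_right sum_mem w \<psi> gram_schmidt_mem)
  also have "(\<Sum>i<k. ip (\<psi> k) (e i) * ip ?w (e i)) = 0"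
    using assms by (intro sum.neutral) (simp add: fourier_remainder_orthogonal)
  finally have *: "ip ?w (\<psi> k) = ip ?w ?r" by simp
  show ?thesis
  proof (cases "ip ?r ?r = 0")
    case True
    then show ?thesis using * null_right[OF w gs_residual_mem] by simp
  next
    case False
    have "ip ?w (e k) = 1 / sqrt (ip ?r ?r) * ip ?w ?r"
      unfolding gram_schmidt_eq[of _ k]
      by (rule scale_right[OF gs_residual_mem w])
    then show ?thesis
      using * False fourier_remainder_orthogonal[OF assms] by simp
  qed
qed

text \<open>Pythagoras: \<open>P m - P n\<close> is a combination of the \<open>e i\<close> with m
  <= i < n, hence orthogonal to \<open>P n\<close>.\<close>

lemma fourier_remainder_diff_norm:
  assumes "v \<in> V" "m \<le> n"
  defines "P \<equiv> fourier_remainder \<psi> v"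
  shows "ip (\<lambda>t. P m t - P n t) (\<lambda>t. P m t - P n t) = ip (P m) (P m) - ip (P n) (P n)"
proof -
  have mem: "P k \<in> V" for k unfolding P_def by (rule fourier_remainder_mem[OF assms(1)])
  have *: "P m t - P n t = (\<Sum>i\<in>{m..<n}. ip v (e i) * e i t)" for t
    using assms(2) sum_diff_nat_ivl[of 0 m n "\<lambda>i. ip v (e i) * e i t"]
    by (auto simp: P_def fourier_remainder_def lessThan_atLeast0)
  have "ip (P n) (\<lambda>t. P m t - P n t) = (\<Sum>i\<in>{m..<n}. ip v (e i) * ip (P n) (e i))"
    unfolding * by (simp add: sum_right mem gram_schmidt_mem)
  also have "\<dots> = 0"
    by (intro sum.neutral) (simp add: P_def fourier_remainder_orthogonal assms)
  finally have "ip (P n) (P m) = ip (P n) (P n)"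
    by (simp add: diff_right mem)
  then show ?thesis
    by (simp add: diff_right diff_left diff_mem mem commute[of "P m" "P n"])
qed

text \<open>Bessel's inequality in disguise: the squared norms of the remainders decrease.\<close>

lemma fourier_remainder_Cauchy:
  assumes "v \<in> V" "0 < \<epsilon>"
  defines "P \<equiv> fourier_remainder \<psi> v"
  shows "\<exists>N. \<forall>m\<ge>N. \<forall>n\<ge>m. ip (\<lambda>t. P m t - P n t) (\<lambda>t. P m t - P n t) < \<epsilon>"
proof -
  have mem: "P k \<in> V" for k unfolding P_def by (rule fourier_remainder_mem[OF assms(1)])
  have diff: "ip (\<lambda>t. P m t - P n t) (\<lambda>t. P m t - P n t) = ip (P m) (P m) - ip (P n) (P n)"
    if "m \<le> n" for m n
    unfolding P_def by (rule fourier_remainder_diff_norm[OF assms(1) that])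
  have "decseq (\<lambda>n. ip (P n) (P n))"
    unfolding decseq_def
  proof (intro allI impI)
    fix m n :: nat assume "m \<le> n"
    then show "ip (P n) (P n) \<le> ip (P m) (P m)"
      using diff[of m n] nonneg[OF diff_mem[OF mem[of m] mem[of n]]] by simp
  qed
  then have "convergent (\<lambda>n. ip (P n) (P n))"
    using nonneg[OF mem] decseq_convergent[of "\<lambda>n. ip (P n) (P n)" 0] unfolding convergent_def
    by blast
  then have "Cauchy (\<lambda>n. ip (P n) (P n))"
    by (rule convergent_Cauchy)
  then obtain N where N: "\<And>m n. m \<ge> N \<Longrightarrow> n \<ge> N \<Longrightarrow> \<bar>ip (P m) (P m) - ip (P n) (P n)\<bar> < \<epsilon>"
    using \<open>0 < \<epsilon>\<close> unfolding Cauchy_def dist_real_def by blast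
  show ?thesis
  proof (intro exI[of _ N] allI impI)
    fix m n assume "N \<le> m" "m \<le> n"
    then show "ip (\<lambda>t. P m t - P n t) (\<lambda>t. P m t - P n t) < \<epsilon>"
      using N[of m n] diff by simp
  qed
qed

end

end

section \<open>Absolutely continuous functions\<close>

lemma division_of_real_interval:
  fixes \<D> :: "real set set"
  assumes "\<D> division_of S" "S \<subseteq> {a..b}" "K \<in> \<D>"
  shows "Inf K \<in> {a..b}" "Sup K \<in> {a..b}" "Inf K \<le> Sup K" "K = {Inf K..Sup K}"
proof -
  obtain c d where K: "K = cbox c d" using division_ofD(4)[OF assms(1,3)] by blast
  have "K \<noteq> {}" "K \<subseteq> {a..b}" using division_ofD(2,3)[OF assms(1,3)] assms(2) by auto
  then show "Inf K \<in> {a..b}" "Sup K \<in> {a..b}" "Inf K \<le> Sup K" "K = {Inf K..Sup K}"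
    unfolding K by auto
qed

lemma abs_cont_IccE:
  assumes "abs_cont_Icc a b f" "0 < \<epsilon>"
  obtains \<delta> where "\<delta> > 0" "\<And>\<D> S. \<D> division_of S \<Longrightarrow> S \<subseteq> {a..b} \<Longrightarrow>
      (\<Sum>K\<in>\<D>. Sup K - Inf K) < \<delta> \<Longrightarrow> (\<Sum>K\<in>\<D>. \<bar>f (Sup K) - f (Inf K)\<bar>) < \<epsilon>"
proof -
  from assms[unfolded abs_cont_Icc_def] obtain \<delta> where \<delta>: "\<delta> > 0 \<and> (\<forall>\<D> S. \<D> division_of S \<and> S \<subseteq> {a..b} \<and>
      (\<Sum>K\<in>\<D>. Sup K - Inf K) < \<delta> \<longrightarrow> (\<Sum>K\<in>\<D>. \<bar>f (Sup K) - f (Inf K)\<bar>) < \<epsilon>)"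
    by presburger
  show thesis
    by (rule that[of \<delta>]) (use \<delta> in auto)
qed

text \<open>A single epsilon-delta argument from which Lipschitz functions, linear combinations,
  products and functions agreeing on the interval are all obtained.\<close>

lemma abs_cont_Icc_dominated:
  assumes f: "abs_cont_Icc a b f" and g: "abs_cont_Icc a b g"
    and le: "\<And>x y. x \<in> {a..b} \<Longrightarrow> y \<in> {a..b} \<Longrightarrow>
      \<bar>h y - h x\<bar> \<le> C * (\<bar>f y - f x\<bar> + \<bar>g y - g x\<bar>)"
  shows "abs_cont_Icc a b h"
  unfolding abs_cont_Icc_def
proof (intro allI impI)
  fix \<epsilon> :: real assume "0 < \<epsilon>"
  \<comment> \<open>The 2 accounts for the two functions; the summand 1 keeps the divisor positive
    and the last inequality strict even for \<open>C = 0\<close>.\<close>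
  define \<epsilon>' where "\<epsilon>' = \<epsilon> / (2 * (\<bar>C\<bar> + 1))"
  have \<epsilon>': "\<epsilon>' > 0" using \<open>0 < \<epsilon>\<close> by (simp add: \<epsilon>'_def field_simps)
  obtain \<delta>f where \<delta>f: "\<delta>f > 0" "\<And>\<D> S. \<D> division_of S \<Longrightarrow> S \<subseteq> {a..b} \<Longrightarrow>
      (\<Sum>K\<in>\<D>. Sup K - Inf K) < \<delta>f \<Longrightarrow> (\<Sum>K\<in>\<D>. \<bar>f (Sup K) - f (Inf K)\<bar>) < \<epsilon>'"
    by (fact abs_cont_IccE[OF f \<epsilon>'])
  obtain \<delta>g where \<delta>g: "\<delta>g > 0" "\<And>\<D> S. \<D> division_of S \<Longrightarrow> S \<subseteq> {a..b} \<Longrightarrow>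
      (\<Sum>K\<in>\<D>. Sup K - Inf K) < \<delta>g \<Longrightarrow> (\<Sum>K\<in>\<D>. \<bar>g (Sup K) - g (Inf K)\<bar>) < \<epsilon>'"
    by (fact abs_cont_IccE[OF g \<epsilon>'])
  show "\<exists>\<delta>>0. \<forall>\<D> S. \<D> division_of S \<and> S \<subseteq> {a..b} \<and> (\<Sum>K\<in>\<D>. Sup K - Inf K) < \<delta>
        \<longrightarrow> (\<Sum>K\<in>\<D>. \<bar>h (Sup K) - h (Inf K)\<bar>) < \<epsilon>"
  proof (intro exI[of _ "min \<delta>f \<delta>g"] conjI allI impI)
    fix \<D> S assume D: "\<D> division_of S \<and> S \<subseteq> {a..b} \<and> (\<Sum>K\<in>\<D>. Sup K - Inf K) < min \<delta>f \<delta>g"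
    let ?F = "\<Sum>K\<in>\<D>. \<bar>f (Sup K) - f (Inf K)\<bar>" and ?G = "\<Sum>K\<in>\<D>. \<bar>g (Sup K) - g (Inf K)\<bar>"
    have FG: "?F < \<epsilon>'" "?G < \<epsilon>'" using D \<delta>f(2)[of \<D> S] \<delta>g(2)[of \<D> S] by auto
    have "(\<Sum>K\<in>\<D>. \<bar>h (Sup K) - h (Inf K)\<bar>)
        \<le> (\<Sum>K\<in>\<D>. \<bar>C\<bar> * (\<bar>f (Sup K) - f (Inf K)\<bar> + \<bar>g (Sup K) - g (Inf K)\<bar>))"
    proof (rule sum_mono)
      fix K assume "K \<in> \<D>"
      then have "\<bar>h (Sup K) - h (Inf K)\<bar> \<le> C * (\<bar>f (Sup K) - f (Inf K)\<bar> + \<bar>g (Sup K) - g (Inf K)\<bar>)"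
        using D division_of_real_interval[of \<D> S a b K] by (intro le) auto
      also have "\<dots> \<le> \<bar>C\<bar> * (\<bar>f (Sup K) - f (Inf K)\<bar> + \<bar>g (Sup K) - g (Inf K)\<bar>)"
        by (intro mult_right_mono) auto
      finally show "\<bar>h (Sup K) - h (Inf K)\<bar> \<le> \<dots>" .
    qed
    also have "\<dots> = \<bar>C\<bar> * (?F + ?G)"
      by (simp add: sum_distrib_left[symmetric] sum.distrib)
    also have "\<dots> \<le> \<bar>C\<bar> * (2 * \<epsilon>')"
      using FG by (intro mult_left_mono) auto
    also have "\<dots> < \<epsilon>"
      using \<open>0 < \<epsilon>\<close> by (simp add: \<epsilon>'_def field_simps)
    finally show "(\<Sum>K\<in>\<D>. \<bar>h (Sup K) - h (Inf K)\<bar>) < \<epsilon>" .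
  qed (use \<delta>f \<delta>g in auto)
qed

lemma abs_cont_Icc_ident: "abs_cont_Icc a b (\<lambda>x. x)"
  unfolding abs_cont_Icc_def
proof (intro allI impI)
  fix \<epsilon> :: real assume "0 < \<epsilon>"
  have "(\<Sum>K\<in>\<D>. \<bar>Sup K - Inf K\<bar>) = (\<Sum>K\<in>\<D>. Sup K - Inf K)"
    if "\<D> division_of S" "S \<subseteq> {a..b}" for \<D> :: "real set set" and S
    using division_of_real_interval(3)[OF that] by (intro sum.cong) auto
  then show "\<exists>\<delta>>0. \<forall>\<D> S. \<D> division_of S \<and> S \<subseteq> {a..b} \<and> (\<Sum>K\<in>\<D>. Sup K - Inf K) < \<delta>
        \<longrightarrow> (\<Sum>K\<in>\<D>. \<bar>Sup K - Inf K\<bar>) < \<epsilon>"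
    using \<open>0 < \<epsilon>\<close> by (intro exI[of _ \<epsilon>]) auto
qed

lemma abs_cont_Icc_lipschitz:
  assumes "\<And>x y. x \<in> {a..b} \<Longrightarrow> y \<in> {a..b} \<Longrightarrow> \<bar>h y - h x\<bar> \<le> C * \<bar>y - x\<bar>"
  shows "abs_cont_Icc a b h"
  \<comment> \<open>The identity plays the part of both dominating functions, so the constant is
    halved.\<close>
  by (rule abs_cont_Icc_dominated[OF abs_cont_Icc_ident abs_cont_Icc_ident, of _ _ _ "C / 2"])
     (use assms in auto)

lemma abs_cont_Icc_subinterval:
  assumes "abs_cont_Icc a b f" "{c..d} \<subseteq> {a..b}"
  shows "abs_cont_Icc c d f"
  unfolding abs_cont_Icc_def
proof (intro allI impI)
  fix \<epsilon> :: real assume "0 < \<epsilon>"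
  obtain \<delta> where "\<delta> > 0" "\<And>\<D> S. \<D> division_of S \<Longrightarrow> S \<subseteq> {a..b} \<Longrightarrow>
      (\<Sum>K\<in>\<D>. Sup K - Inf K) < \<delta> \<Longrightarrow> (\<Sum>K\<in>\<D>. \<bar>f (Sup K) - f (Inf K)\<bar>) < \<epsilon>"
    by (fact abs_cont_IccE[OF assms(1) \<open>0 < \<epsilon>\<close>])
  then show "\<exists>\<delta>>0. \<forall>\<D> S. \<D> division_of S \<and> S \<subseteq> {c..d} \<and> (\<Sum>K\<in>\<D>. Sup K - Inf K) < \<delta>
        \<longrightarrow> (\<Sum>K\<in>\<D>. \<bar>f (Sup K) - f (Inf K)\<bar>) < \<epsilon>"
    using order_trans[OF _ assms(2)] by (intro exI[of _ \<delta>] conjI allI impI) blast+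
qed

lemma abs_cont_Icc_cong:
  assumes "abs_cont_Icc a b f" "\<And>x. x \<in> {a..b} \<Longrightarrow> g x = f x"
  shows "abs_cont_Icc a b g"
  by (rule abs_cont_Icc_dominated[OF assms(1,1), of _ 1]) (simp add: assms(2))

lemma abs_cont_Icc_continuous_on:
  assumes "abs_cont_Icc a b f"
  shows "continuous_on {a..b} f"
  unfolding continuous_on_iff
proof (intro ballI allI impI)
  fix x \<epsilon> :: real assume x: "x \<in> {a..b}" and "0 < \<epsilon>"
  obtain \<delta> where \<delta>: "\<delta> > 0" "\<And>\<D> S. \<D> division_of S \<Longrightarrow> S \<subseteq> {a..b} \<Longrightarrow>
      (\<Sum>K\<in>\<D>. Sup K - Inf K) < \<delta> \<Longrightarrow> (\<Sum>K\<in>\<D>. \<bar>f (Sup K) - f (Inf K)\<bar>) < \<epsilon>"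
    by (fact abs_cont_IccE[OF assms \<open>0 < \<epsilon>\<close>])
  have *: "\<bar>f d - f c\<bar> < \<epsilon>" if "c \<in> {a..b}" "d \<in> {a..b}" "c \<le> d" "d - c < \<delta>" for c d
    using \<delta>(2)[of "{{c..d}}" "{c..d}"] that division_of_self[of c d] by auto
  have "dist (f y) (f x) < \<epsilon>" if "y \<in> {a..b}" "dist y x < \<delta>" for y
    using *[of x y] *[of y x] x that by (cases "x \<le> y") (auto simp: dist_real_def abs_minus_commute)
  then show "\<exists>d>0. \<forall>x'\<in>{a..b}. dist x' x < d \<longrightarrow> dist (f x') (f x) < \<epsilon>"
    using \<open>\<delta> > 0\<close> by blast
qed

text \<open>The gauge is chosen inside a small open neighbourhood of the exceptional null set, where
  absolute continuity controls the increments; elsewhere it comes from differentiability.\<close>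

lemma abs_cont_Icc_has_integral:
  fixes F F' :: "real \<Rightarrow> real"
  assumes "a \<le> b" and ac: "abs_cont_Icc a b F" and N: "negligible N"
    and der: "\<And>x. x \<in> {a..b} - N \<Longrightarrow> (F has_vector_derivative F' x) (at x within {a..b})"
  shows "(F' has_integral (F b - F a)) {a..b}"
proof -
  \<comment> \<open>With value 0 on \<open>N\<close>, the terms of a Riemann sum whose tags lie in
    \<open>N\<close> reduce to bare increments of \<open>F\<close>.\<close>
  define G where "G x = (if x \<in> N then 0 else F' x)" for x
  have "(G has_integral (F b - F a)) {a..b}"
    unfolding has_integral_real
  proof (intro allI impI)
    fix e :: real assume "0 < e"
    \<comment> \<open>The summand 1 makes \<open>e1 * (b - a) < e / 2\<close> strict and covers
      \<open>a = b\<close>.\<close>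
    define e1 where "e1 = e / (2 * (b - a + 1))"
    have e1: "0 < e1" "e1 * (b - a) < e / 2"
      using \<open>0 < e\<close> \<open>a \<le> b\<close> by (auto simp: e1_def field_simps)
    have "\<exists>d>0. x \<in> {a..b} - N \<longrightarrow>
         (\<forall>y\<in>{a..b}. \<bar>y - x\<bar> < d \<longrightarrow> \<bar>F y - F x - (y - x) * G x\<bar> \<le> e1 * \<bar>y - x\<bar>)" for x
    proof (cases "x \<in> {a..b} - N")
      case True
      then show ?thesis
        using der[OF True] e1(1) unfolding has_vector_derivative_def has_derivative_within_alt
        by (simp add: G_def)
    qed (auto intro: exI[of _ 1])
    then have "\<exists>d. \<forall>x. 0 < d x \<and> (x \<in> {a..b} - N \<longrightarrow>
         (\<forall>y\<in>{a..b}. \<bar>y - x\<bar> < d x \<longrightarrow> \<bar>F y - F x - (y - x) * G x\<bar> \<le> e1 * \<bar>y - x\<bar>))"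
      by (intro choice allI)
    then obtain d where d: "\<And>x. 0 < d x"
      "\<And>x y. x \<in> {a..b} - N \<Longrightarrow> y \<in> {a..b} \<Longrightarrow> \<bar>y - x\<bar> < d x \<Longrightarrow>
         \<bar>F y - F x - (y - x) * G x\<bar> \<le> e1 * \<bar>y - x\<bar>"
      by blast
    have "0 < e / 2" using \<open>0 < e\<close> by simp
    obtain \<delta> where \<delta>: "\<delta> > 0" "\<And>\<D> S. \<D> division_of S \<Longrightarrow> S \<subseteq> {a..b} \<Longrightarrow>
        (\<Sum>K\<in>\<D>. Sup K - Inf K) < \<delta> \<Longrightarrow> (\<Sum>K\<in>\<D>. \<bar>F (Sup K) - F (Inf K)\<bar>) < e / 2"
      by (fact abs_cont_IccE[OF ac \<open>0 < e / 2\<close>])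
    have N': "N \<in> sets lebesgue" "N \<in> null_sets lebesgue"
      using N negligible_iff_null_sets by auto
    \<comment> \<open>The outer approximation bounds \<open>U - N\<close>; adding the null set
      \<open>N\<close> does not change the measure. Fineness will force every interval tagged in
      \<open>N\<close> into \<open>U\<close>, so their total length stays below
      \<open>\<delta>\<close>.\<close>
    obtain U where U: "open U" "N \<subseteq> U" "U - N \<in> lmeasurable" "emeasure lebesgue (U - N) < ennreal \<delta>"
      using sets_lebesgue_outer_open[OF N'(1) \<delta>(1)] by blast
    have "U \<in> lmeasurable"
      using U(2,3) N' by (metis Diff_partition fmeasurable.Un fmeasurableI_null_sets)
    have "U = (U - N) \<union> N" using U(2) by auto
    then have "emeasure lebesgue U = emeasure lebesgue (U - N)"
      using emeasure_Un_null_set[of "U - N" lebesgue N] U(3) N'(2) by auto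
    then have mU: "measure lebesgue U < \<delta>"
      using U(4) \<open>U \<in> lmeasurable\<close> ennreal_less_iff[of "measure lebesgue U" \<delta>]
      by (metis emeasure_eq_measure2 measure_nonneg)
    define \<gamma> where "\<gamma> x = (if x \<in> N then U else ball x (d x))" for x
    show "\<exists>\<gamma>. gauge \<gamma> \<and> (\<forall>\<D>. \<D> tagged_division_of {a..b} \<and> \<gamma> fine \<D> \<longrightarrow>
             norm ((\<Sum>(x, k)\<in>\<D>. measure lborel k *\<^sub>R G x) - (F b - F a)) < e)"
    proof (intro exI[of _ \<gamma>] conjI allI impI)
      show "gauge \<gamma>"
        using U(1,2) d(1) by (auto simp: gauge_def \<gamma>_def)
    next
      fix p assume "p tagged_division_of {a..b} \<and> \<gamma> fine p"
      then have p: "p tagged_division_of {a..b}" and fine: "\<gamma> fine p" by auto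
      note fin = tagged_division_ofD(1)[OF p]
      define p' where "p' = {(x, K) \<in> p. x \<in> N}"
      have p'p: "p' \<subseteq> p" by (auto simp: p'_def)
      have "p' tagged_partial_division_of {a..b}"
        using p p'p tagged_partial_division_subset unfolding tagged_division_of_def by blast
      note p'd = partial_division_of_tagged_division[OF this]
        tagged_partial_division_of_Union_self[OF this]
      have ends: "\<exists>u v. K = {u..v} \<and> u \<le> v \<and> x \<in> {u..v} \<and> u \<in> {a..b} \<and> v \<in> {a..b}"
        if "(x, K) \<in> p" for x K
      proof -
        obtain u v where "K = cbox u v" using tagged_division_ofD(4)[OF p \<open>(x, K) \<in> p\<close>] by blast
        then show ?thesis
          using tagged_division_ofD(2,3)[OF p \<open>(x, K) \<in> p\<close>] by (intro exI[of _ u] exI[of _ v]) auto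
      qed
      have sub: "\<Union>(snd ` p') \<subseteq> {a..b} \<inter> U"
      proof safe
        fix x K y assume "(x, K) \<in> p'" and y: "y \<in> snd (x, K)"
        then have "(x, K) \<in> p" "x \<in> N" by (auto simp: p'_def)
        then show "y \<in> {a..b}" "y \<in> U"
          using tagged_division_ofD(3)[OF p \<open>(x, K) \<in> p\<close>] fineD[OF fine \<open>(x, K) \<in> p\<close>] y
          by (auto simp: \<gamma>_def)
      qed
      have "(\<Sum>K\<in>snd ` p'. Sup K - Inf K) = (\<Sum>K\<in>snd ` p'. measure lebesgue K)"
      proof (rule sum.cong[OF refl])
        fix K assume "K \<in> snd ` p'"
        then obtain x where "(x, K) \<in> p" using p'p by auto
        then obtain u v where "K = {u..v}" "u \<le> v" using ends by blast
        then show "Sup K - Inf K = measure lebesgue K" by simp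
      qed
      also have "\<dots> = measure lebesgue (\<Union>(snd ` p'))"
        by (rule content_division[OF p'd(1)])
      also have "\<dots> \<le> measure lebesgue U"
        using sub lmeasurable_division[OF p'd(1)] \<open>U \<in> lmeasurable\<close>
        by (intro measure_mono_fmeasurable) auto
      finally have "(\<Sum>K\<in>snd ` p'. Sup K - Inf K) < \<delta>" using mU by simp
      then have "(\<Sum>K\<in>snd ` p'. \<bar>F (Sup K) - F (Inf K)\<bar>) < e / 2"
        using sub by (intro \<delta>(2)[OF p'd(1)]) auto
      moreover have "(\<Sum>(x, K)\<in>p'. \<bar>F (Sup K) - F (Inf K)\<bar>) = (\<Sum>K\<in>snd ` p'. \<bar>F (Sup K) - F (Inf K)\<bar>)"
      proof -
        \<comment> \<open>Two tags can share an interval only if it is degenerate, so passing from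
          tagged to untagged sums requires a summand vanishing on degenerate boxes. The empty box is
          among them, and there \<open>F (Sup K) - F (Inf K)\<close> has no useful value.\<close>
        define h where "h K = (if K = {} then 0 else \<bar>F (Sup K) - F (Inf K)\<bar>)" for K
        have h: "h K = \<bar>F (Sup K) - F (Inf K)\<bar>" if "(x, K) \<in> p'" for x K
          using tagged_division_ofD(2)[OF p, of x K] that p'p by (auto simp: h_def)
        have "(\<Sum>(x, K)\<in>p'. h K) = (\<Sum>K\<in>snd ` p'. h K)"
          by (rule sum.over_tagged_division_lemma[OF p'd(2)]) (auto simp: h_def)
        moreover have "(\<Sum>(x, K)\<in>p'. h K) = (\<Sum>(x, K)\<in>p'. \<bar>F (Sup K) - F (Inf K)\<bar>)"
          using h by (intro sum.cong) auto
        moreover have "(\<Sum>K\<in>snd ` p'. h K) = (\<Sum>K\<in>snd ` p'. \<bar>F (Sup K) - F (Inf K)\<bar>)"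
          using h by (intro sum.cong) auto
        ultimately show ?thesis by simp
      qed
      ultimately have small: "(\<Sum>(x, K)\<in>p'. \<bar>F (Sup K) - F (Inf K)\<bar>) < e / 2" by simp
      have ba: "b - a = (\<Sum>(x,K)\<in>p. Sup K - Inf K)" "F b - F a = (\<Sum>(x,K)\<in>p. F (Sup K) - F (Inf K))"
        using additive_tagged_division_1[OF \<open>a \<le> b\<close>, where f = "\<lambda>x. x"]
          additive_tagged_division_1[OF \<open>a \<le> b\<close>, where f = F] p by auto
      have "norm ((\<Sum>(x, K)\<in>p. measure lborel K *\<^sub>R G x) - (F b - F a))
          = norm (\<Sum>(x, K)\<in>p. measure lborel K *\<^sub>R G x - (F (Sup K) - F (Inf K)))"
        unfolding ba(2) by (simp add: sum_subtractf case_prod_unfold)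
      also have "\<dots> \<le> (\<Sum>(x, K)\<in>p. (if x \<in> N then \<bar>F (Sup K) - F (Inf K)\<bar> else 0) + e1 * (Sup K - Inf K))"
      proof (rule sum_norm_le, clarify)
        fix x K assume xK: "(x, K) \<in> p"
        then obtain u v where K: "K = {u..v}" "u \<le> v" "x \<in> {u..v}" "u \<in> {a..b}" "v \<in> {a..b}"
          using ends by blast
        show "norm (measure lborel K *\<^sub>R G x - (F (Sup K) - F (Inf K)))
            \<le> (if x \<in> N then \<bar>F (Sup K) - F (Inf K)\<bar> else 0) + e1 * (Sup K - Inf K)"
        proof (cases "x \<in> N")
          case True
          moreover have "0 \<le> e1 * (v - u)" using K e1 by simp
          ultimately show ?thesis using K by (simp add: G_def)
        next
          case False
          have x: "x \<in> {a..b} - N" using K False by auto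
          have "K \<subseteq> ball x (d x)" using fineD[OF fine xK] False by (simp add: \<gamma>_def)
          moreover have "u \<in> K" "v \<in> K" using K by auto
          ultimately have "u \<in> ball x (d x)" "v \<in> ball x (d x)" by blast+
          then have "\<bar>F u - F x - (u - x) * G x\<bar> \<le> e1 * \<bar>u - x\<bar>" "\<bar>F v - F x - (v - x) * G x\<bar> \<le> e1 * \<bar>v - x\<bar>"
            using K(4,5) d(2)[OF x, of u] d(2)[OF x, of v] by (auto simp: dist_real_def abs_minus_commute)
          \<comment> \<open>The tag lies between the endpoints, so the two one-sided errors add up
            to the length of the interval.\<close>
          moreover have "e1 * \<bar>u - x\<bar> + e1 * \<bar>v - x\<bar> = e1 * (v - u)"
            using K by (simp add: algebra_simps)
          moreover have "(v - u) * G x - (F v - F u) = (F u - F x - (u - x) * G x) - (F v - F x - (v - x) * G x)"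
            by (simp add: algebra_simps)
          ultimately have "\<bar>(v - u) * G x - (F v - F u)\<bar> \<le> e1 * (v - u)" by linarith
          then show ?thesis using K False by simp
        qed
      qed
      also have "\<dots> = (\<Sum>(x, K)\<in>p. if x \<in> N then \<bar>F (Sup K) - F (Inf K)\<bar> else 0) + e1 * (b - a)"
        unfolding ba(1) by (simp add: sum.distrib case_prod_unfold sum_distrib_left)
      also have "(\<Sum>(x, K)\<in>p. if x \<in> N then \<bar>F (Sup K) - F (Inf K)\<bar> else 0)
          = (\<Sum>(x, K)\<in>p'. \<bar>F (Sup K) - F (Inf K)\<bar>)"
        unfolding p'_def using fin by (intro sum.mono_neutral_cong_right) (auto split: if_splits)
      finally show "norm ((\<Sum>(x, K)\<in>p. measure lborel K *\<^sub>R G x) - (F b - F a)) < e"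
        using small e1(2) by linarith
    qed
  qed
  then show ?thesis
    by (rule has_integral_spike[OF N, rotated]) (auto simp: G_def)
qed

section \<open>Square integrable derivatives\<close>

text \<open>Measurability is a separate clause: a function with nonmeasurable sign can have an
  integrable square.\<close>

definition sq_integrable :: "'a measure \<Rightarrow> 'a set \<Rightarrow> ('a \<Rightarrow> real) \<Rightarrow> bool" where
  "sq_integrable M A h \<longleftrightarrow> set_borel_measurable M A h \<and> set_integrable M A (\<lambda>x. (h x)\<^sup>2)"

lemma set_borel_measurable_times:
  fixes p q :: "'a \<Rightarrow> real"
  assumes "set_borel_measurable M A p" "set_borel_measurable M A q"
  shows "set_borel_measurable M A (\<lambda>x. p x * q x)"
proof -
  have "(\<lambda>x. indicator A x *\<^sub>R (p x * q x)) = (\<lambda>x. (indicator A x *\<^sub>R p x) * (indicator A x *\<^sub>R q x))"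
    by (auto simp: indicator_def)
  then show ?thesis
    using borel_measurable_times[OF assms[unfolded set_borel_measurable_def]]
    by (simp only: set_borel_measurable_def)
qed

lemma set_borel_measurable_add_scale:
  fixes p q :: "'a \<Rightarrow> real"
  assumes "set_borel_measurable M A p" "set_borel_measurable M A q"
  shows "set_borel_measurable M A (\<lambda>x. p x + c * q x)"
proof -
  have "(\<lambda>x. indicator A x *\<^sub>R (p x + c * q x)) = (\<lambda>x. (indicator A x *\<^sub>R p x) + c * (indicator A x *\<^sub>R q x))"
    by (auto simp: algebra_simps)
  then show ?thesis
    using borel_measurable_add[OF assms(1)[unfolded set_borel_measurable_def]
      borel_measurable_times[OF borel_measurable_const[of c] assms(2)[unfolded set_borel_measurable_def]]]
    by (simp only: set_borel_measurable_def)
qed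

lemma sq_integrable_times:
  assumes p: "sq_integrable M A p" and q: "sq_integrable M A q"
  shows "set_integrable M A (\<lambda>x. p x * q x)"
proof (rule set_integrable_bound)
  show "set_integrable M A (\<lambda>x. (p x)\<^sup>2 + (q x)\<^sup>2)"
    using p q by (intro set_integral_add) (auto simp: sq_integrable_def)
  show "set_borel_measurable M A (\<lambda>x. p x * q x)"
    using p q by (intro set_borel_measurable_times) (auto simp: sq_integrable_def)
  have "\<bar>s * t\<bar> \<le> s\<^sup>2 + t\<^sup>2" for s t :: real
  proof -
    have "0 \<le> (\<bar>s\<bar> - \<bar>t\<bar>)\<^sup>2" "0 \<le> \<bar>s\<bar> * \<bar>t\<bar>" by auto
    then show ?thesis unfolding power2_diff power2_abs abs_mult by linarith
  qed
  then show "AE x in M. x \<in> A \<longrightarrow> norm (p x * q x) \<le> norm ((p x)\<^sup>2 + (q x)\<^sup>2)"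
    by simp
qed

lemma sq_integrable_add_scale:
  assumes p: "sq_integrable M A p" and q: "sq_integrable M A q"
  shows "sq_integrable M A (\<lambda>x. p x + c * q x)"
proof -
  have "set_integrable M A (\<lambda>x. ((p x)\<^sup>2 + (2 * c) * (p x * q x)) + c\<^sup>2 * (q x)\<^sup>2)"
    using sq_integrable_times[OF p q] p q
    by (intro set_integral_add(1) set_integrable_mult_right) (auto simp: sq_integrable_def)
  then show ?thesis
    using p q set_borel_measurable_add_scale[of M A p q c]
    by (simp add: sq_integrable_def power2_eq_square algebra_simps)
qed

lemma semi_inner_product_sq_integrable:
  "semi_inner_product {h. sq_integrable M A h} (\<lambda>p q. LINT x:A|M. p x * q x)"
proof
  show "(\<lambda>t. 0) \<in> {h. sq_integrable M A h}"
    by (simp add: sq_integrable_def set_borel_measurable_def set_integrable_def)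
next
  fix u v c assume "u \<in> {h. sq_integrable M A h}" "v \<in> {h. sq_integrable M A h}"
  then show "(\<lambda>t. u t + c * v t) \<in> {h. sq_integrable M A h}"
    by (simp add: sq_integrable_add_scale)
next
  fix u v w :: "'a \<Rightarrow> real" and c :: real
  assume "u \<in> {h. sq_integrable M A h}" "v \<in> {h. sq_integrable M A h}" "w \<in> {h. sq_integrable M A h}"
  then have i: "set_integrable M A (\<lambda>x. u x * w x)" "set_integrable M A (\<lambda>x. v x * w x)"
    by (auto intro: sq_integrable_times)
  have "(LINT x:A|M. (u x + c * v x) * w x) = (LINT x:A|M. u x * w x + c * (v x * w x))"
    by (simp add: algebra_simps)
  also have "\<dots> = (LINT x:A|M. u x * w x) + (LINT x:A|M. c * (v x * w x))"
    by (rule set_integral_add(2)[OF i(1) set_integrable_mult_right[OF i(2)]])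
  finally show "(LINT x:A|M. (u x + c * v x) * w x) = (LINT x:A|M. u x * w x) + c * (LINT x:A|M. v x * w x)"
    by simp
next
  fix u v :: "'a \<Rightarrow> real" show "(LINT x:A|M. u x * v x) = (LINT x:A|M. v x * u x)"
    by (simp add: mult.commute)
next
  fix u :: "'a \<Rightarrow> real" show "0 \<le> (LINT x:A|M. u x * u x)"
    unfolding set_lebesgue_integral_def by (intro integral_nonneg_AE) auto
qed

text \<open>Completeness of Lebesgue measure: changing a measurable function on a null set keeps it
  measurable. Needed because \<open>deriv_Icc\<close> takes uncontrolled values where the derivative
  fails to exist.\<close>

lemma sq_integrable_AE_cong:
  fixes p q :: "'a::euclidean_space \<Rightarrow> real"
  assumes p: "sq_integrable lebesgue A p" and ae: "AE x in lebesgue. x \<in> A \<longrightarrow> q x = p x"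
  shows "sq_integrable lebesgue A q"
proof -
  have *: "set_borel_measurable lebesgue A q"
    unfolding set_borel_measurable_def
  proof (rule borel_measurable_AE)
    show "(\<lambda>x. indicator A x *\<^sub>R p x) \<in> borel_measurable lebesgue"
      using p by (simp add: sq_integrable_def set_borel_measurable_def)
    show "AE x in lebesgue. indicator A x *\<^sub>R p x = indicator A x *\<^sub>R q x"
      using ae by eventually_elim (auto simp: indicator_def)
  qed
  have "set_integrable lebesgue A (\<lambda>x. (q x)\<^sup>2)"
  proof (rule set_integrable_bound)
    show "set_integrable lebesgue A (\<lambda>x. (p x)\<^sup>2)" using p by (simp add: sq_integrable_def)
    show "set_borel_measurable lebesgue A (\<lambda>x. (q x)\<^sup>2)"
      unfolding power2_eq_square by (rule set_borel_measurable_times[OF * *])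
    show "AE x in lebesgue. x \<in> A \<longrightarrow> norm ((q x)\<^sup>2) \<le> norm ((p x)\<^sup>2)"
      using ae by eventually_elim auto
  qed
  then show ?thesis using * by (simp add: sq_integrable_def)
qed

lemma sq_integrable_subset:
  assumes "sq_integrable M A p" "B \<subseteq> A" "B \<in> sets M"
  shows "sq_integrable M B p"
proof -
  have "(\<lambda>x. indicator B x *\<^sub>R p x) = (\<lambda>x. indicator B x * (indicator A x *\<^sub>R p x))"
    using assms(2) by (intro ext) (auto split: split_indicator)
  then have "set_borel_measurable M B p"
    using borel_measurable_times[OF borel_measurable_indicator[OF assms(3)], of "\<lambda>x. indicator A x *\<^sub>R p x"]
      assms(1)
    by (simp only: set_borel_measurable_def sq_integrable_def)
  then show ?thesis
    using assms set_integrable_subset unfolding sq_integrable_def by blast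
qed

lemma sq_integrable_continuous_on:
  fixes h :: "real \<Rightarrow> real"
  assumes "continuous_on {a..b} h"
  shows "sq_integrable lebesgue {a..b} h"
proof -
  have "set_integrable lborel {a..b} h" "set_integrable lborel {a..b} (\<lambda>x. (h x)\<^sup>2)"
    using assms by (auto intro!: borel_integrable_atLeastAtMost' continuous_intros)
  then show ?thesis
    unfolding sq_integrable_def set_integrable_def set_borel_measurable_def
    by (auto intro!: integrable_completion[THEN iffD2] measurable_completion)
qed

lemma sq_integrable_continuous_times:
  fixes h :: "real \<Rightarrow> real"
  assumes "continuous_on {a..b} h" and p: "sq_integrable lebesgue {a..b} p"
  shows "sq_integrable lebesgue {a..b} (\<lambda>x. h x * p x)"
proof -
  have *: "set_borel_measurable lebesgue {a..b} (\<lambda>x. h x * p x)"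
    using sq_integrable_continuous_on[OF assms(1)] p
    by (intro set_borel_measurable_times) (auto simp: sq_integrable_def)
  have "bounded (h ` {a..b})"
    by (rule compact_imp_bounded[OF compact_continuous_image[OF assms(1)]]) simp
  then obtain B where "\<forall>y\<in>h ` {a..b}. norm y \<le> B"
    unfolding bounded_iff by blast
  then have B: "\<bar>h x\<bar> \<le> B" if "x \<in> {a..b}" for x
    using that by simp
  have "set_integrable lebesgue {a..b} (\<lambda>x. (h x * p x)\<^sup>2)"
  proof (rule set_integrable_bound)
    show "set_integrable lebesgue {a..b} (\<lambda>x. B\<^sup>2 * (p x)\<^sup>2)"
      using p by (intro set_integrable_mult_right) (simp add: sq_integrable_def)
    show "set_borel_measurable lebesgue {a..b} (\<lambda>x. (h x * p x)\<^sup>2)"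
      unfolding power2_eq_square by (rule set_borel_measurable_times[OF * *])
    have "(h x * p x)\<^sup>2 \<le> B\<^sup>2 * (p x)\<^sup>2" if "x \<in> {a..b}" for x
      using power_mono[OF B[OF that], of 2] by (auto simp: power_mult_distrib intro: mult_right_mono)
    then show "AE x in lebesgue. x \<in> {a..b} \<longrightarrow> norm ((h x * p x)\<^sup>2) \<le> norm (B\<^sup>2 * (p x)\<^sup>2)"
      by auto
  qed
  then show ?thesis using * by (simp add: sq_integrable_def)
qed

section \<open>Derivatives relative to the closed interval, and increments of absolutely continuous
  functions\<close>

lemma deriv_Icc_0 [simp]: "deriv_Icc a b 0 u = u"
  by (simp add: deriv_Icc_def)

lemma deriv_Icc_1: "deriv_Icc a b 1 u x = (if x \<in> {a..b} then vector_derivative u (at x within {a..b}) else 0)"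
  by (simp add: deriv_Icc_def)

lemma deriv_Icc_Suc: "deriv_Icc a b (Suc i) u = deriv_Icc a b 1 (deriv_Icc a b i u)"
  by (simp add: deriv_Icc_def)

lemma has_vector_derivative_deriv_Icc:
  "u differentiable (at x within {a..b}) \<Longrightarrow> x \<in> {a..b} \<Longrightarrow>
     (u has_vector_derivative deriv_Icc a b 1 u x) (at x within {a..b})"
  unfolding deriv_Icc_1 by (simp add: vector_derivative_works)

lemma deriv_Icc_eq:
  fixes u :: "real \<Rightarrow> real"
  assumes "a < b" "x \<in> {a..b}" "(u has_vector_derivative y) (at x within {a..b})"
  shows "deriv_Icc a b 1 u x = y"
  using vector_derivative_within_closed_interval[OF assms] assms(2) by (simp only: deriv_Icc_1 if_True)

lemma deriv_in_L2_iff: "deriv_in_L2 a b u \<longleftrightarrow>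
  (AE x in lebesgue. x \<in> {a..b} \<longrightarrow> u differentiable (at x within {a..b})) \<and>
  sq_integrable lebesgue {a..b} (deriv_Icc a b 1 u)"
  by (simp add: deriv_in_L2_def sq_integrable_def)

text \<open>The increment is the integral of 1 times the derivative; Cauchy-Schwarz on
  \<open>{c..d}\<close> gives the factor \<open>d - c\<close>. It serves both the sup bounds on
  \<open>W26\<close> and the energy bound on grids.\<close>

lemma abs_cont_Icc_increment:
  assumes ac: "abs_cont_Icc a b u" and L2: "deriv_in_L2 a b u" and "a \<le> c" "c \<le> d" "d \<le> b"
  shows "(u d - u c)\<^sup>2 \<le> (d - c) * (LINT x:{c..d}|lebesgue. (deriv_Icc a b 1 u x)\<^sup>2)"
proof -
  let ?u' = "deriv_Icc a b 1 u"
  have sub: "{c..d} \<subseteq> {a..b}" using assms(3-5) by auto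
  obtain N where N: "negligible N" "{x. \<not> (x \<in> {a..b} \<longrightarrow> u differentiable (at x within {a..b}))} \<subseteq> N"
    using L2 unfolding deriv_in_L2_def eventually_ae_filter_negligible by blast
  have "(?u' has_integral (u d - u c)) {c..d}"
  proof (rule abs_cont_Icc_has_integral[OF \<open>c \<le> d\<close> abs_cont_Icc_subinterval[OF ac sub] N(1)])
    fix x assume "x \<in> {c..d} - N"
    then have "x \<in> {a..b}" "x \<notin> N" using sub by blast+
    moreover from this have "u differentiable (at x within {a..b})" using N(2) by blast
    ultimately show "(u has_vector_derivative ?u' x) (at x within {c..d})"
      by (intro has_vector_derivative_within_subset[OF has_vector_derivative_deriv_Icc sub])
  qed
  then have int: "integral {c..d} ?u' = u d - u c" by (rule integral_unique)
  interpret L2: semi_inner_product "{h. sq_integrable lebesgue {c..d} h}"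
      "\<lambda>p q. LINT x:{c..d}|lebesgue. p x * q x"
    by (rule semi_inner_product_sq_integrable)
  have mem: "sq_integrable lebesgue {c..d} (\<lambda>_. 1)" "sq_integrable lebesgue {c..d} ?u'"
    using sq_integrable_subset[OF _ sub] L2 by (auto intro!: sq_integrable_continuous_on simp: deriv_in_L2_iff)
  have "?u' absolutely_integrable_on {c..d}"
    using sq_integrable_times[OF mem] by simp
  then have "(LINT x:{c..d}|lebesgue. ?u' x) = u d - u c"
    using int set_lebesgue_integral_eq_integral(2) by metis
  moreover have "(LINT x:{c..d}|lebesgue. 1 * (1::real)) = d - c"
    using \<open>c \<le> d\<close> by (simp add: set_lebesgue_integral_def)
  ultimately show ?thesis
    using L2.Cauchy_Schwarz[of "\<lambda>_. 1" ?u'] mem by (simp add: power2_eq_square)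
qed

section \<open>Difference quotients over uniform grids\<close>

definition grid_point :: "real \<Rightarrow> real \<Rightarrow> nat \<Rightarrow> nat \<Rightarrow> real" where
  "grid_point a b n j = a + (b - a) * real j / real n"

text \<open>This is the integral of the squared derivative of the piecewise linear interpolant of
  \<open>F\<close>: slope squared times cell width, summed over the cells.\<close>

definition slope_energy :: "real \<Rightarrow> real \<Rightarrow> (real \<Rightarrow> real) \<Rightarrow> nat \<Rightarrow> real" where
  "slope_energy a b F n =
     (\<Sum>j<n. (F (grid_point a b n (Suc j)) - F (grid_point a b n j))\<^sup>2 / ((b - a) / n))"

lemma grid_point_0 [simp]: "grid_point a b n 0 = a"
  by (simp add: grid_point_def)

lemma grid_point_n [simp]: "0 < n \<Longrightarrow> grid_point a b n n = b"
  by (simp add: grid_point_def)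

lemma grid_point_Suc: "grid_point a b n (Suc j) = grid_point a b n j + (b - a) / n"
  by (simp add: grid_point_def distrib_left add_divide_distrib)

lemma grid_point_mono: "a \<le> b \<Longrightarrow> i \<le> j \<Longrightarrow> grid_point a b n i \<le> grid_point a b n j"
  by (simp add: grid_point_def divide_right_mono mult_left_mono)

lemma grid_point_in_Icc:
  assumes "a \<le> b" "0 < n" "j \<le> n"
  shows "grid_point a b n j \<in> {a..b}"
  using grid_point_mono[of a b 0 j n] grid_point_mono[of a b j n n] assms by simp

text \<open>\<open>abs_cont_Icc_increment\<close> on every cell; induction on the number of cells
  glues the integrals together.\<close>

lemma slope_energy_le:
  assumes "a < b" "abs_cont_Icc a b F" "deriv_in_L2 a b F" "0 < n"
  shows "slope_energy a b F n \<le> (LINT x:{a..b}|lebesgue. (deriv_Icc a b 1 F x)\<^sup>2)"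
proof -
  let ?g = "\<lambda>x. (deriv_Icc a b 1 F x)\<^sup>2" and ?p = "grid_point a b n"
  have int: "?g absolutely_integrable_on {a..b}"
    using assms(3) by (simp add: deriv_in_L2_def)
  have abs: "?g absolutely_integrable_on {c..d}" if "a \<le> c" "d \<le> b" for c d
    by (rule set_integrable_subset[OF int]) (use that in auto)
  have "(\<Sum>j<k. (F (?p (Suc j)) - F (?p j))\<^sup>2 / ((b - a) / n)) \<le> integral {a..?p k} ?g" if "k \<le> n" for k
    using that
  proof (induction k)
    case (Suc k)
    have p: "?p k \<in> {a..b}" "?p (Suc k) \<in> {a..b}" "?p k \<le> ?p (Suc k)"
      using Suc.prems assms by (auto intro: grid_point_mono simp del: atLeastAtMost_iff intro!: grid_point_in_Icc)
    have "(F (?p (Suc k)) - F (?p k))\<^sup>2 \<le> (?p (Suc k) - ?p k) * (LINT x:{?p k..?p (Suc k)}|lebesgue. ?g x)"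
      using p by (intro abs_cont_Icc_increment assms) auto
    also have "(LINT x:{?p k..?p (Suc k)}|lebesgue. ?g x) = integral {?p k..?p (Suc k)} ?g"
      using p by (intro set_lebesgue_integral_eq_integral(2) abs) auto
    also have "?p (Suc k) - ?p k = (b - a) / n"
      by (simp add: grid_point_Suc)
    finally have "(F (?p (Suc k)) - F (?p k))\<^sup>2 / ((b - a) / n) \<le> integral {?p k..?p (Suc k)} ?g"
      using assms by (simp add: field_simps)
    moreover have "integral {a..?p k} ?g + integral {?p k..?p (Suc k)} ?g = integral {a..?p (Suc k)} ?g"
      using p by (intro Henstock_Kurzweil_Integration.integral_combine set_lebesgue_integral_eq_integral(1)[OF abs]) auto
    ultimately show ?case using Suc by simp
  qed simp
  from this[of n] show ?thesis
    using assms(4) set_lebesgue_integral_eq_integral(2)[OF int] by (simp add: slope_energy_def)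
qed

text \<open>Measured in mesh widths from \<open>a\<close>, a point at position \<open>y\<close> lies
  in the half-open cell j exactly if j <= y < j + 1, so the floor of \<open>y\<close> is the only
  index. The endpoint \<open>b\<close> would have index \<open>n\<close>, one past the last
  cell.\<close>

lemma grid_index:
  assumes "a < b" "0 < n" "x \<in> {a..<b}"
  defines "i \<equiv> nat \<lfloor>(x - a) * real n / (b - a)\<rfloor>"
  shows "i < n" and "x \<in> {grid_point a b n j..<grid_point a b n (Suc j)} \<longleftrightarrow> j = i"
proof -
  define y where "y = (x - a) * real n / (b - a)"
  have y: "0 \<le> y" "y < n"
    using assms(1-3) by (auto simp: y_def field_simps)
  have i: "real i \<le> y" "y < real i + 1"
    using y(1) unfolding i_def y_def[symmetric] by linarith+
  then show "i < n" using y(2) by linarith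
  have x: "x = a + (b - a) * y / n" using assms(1,2) by (simp add: y_def)
  have "grid_point a b n j \<le> x \<longleftrightarrow> real j \<le> y" for j
    using assms(1,2) unfolding x grid_point_def by (simp add: divide_le_cancel mult_le_cancel_left)
  then have "x \<in> {grid_point a b n j..<grid_point a b n (Suc j)} \<longleftrightarrow> real j \<le> y \<and> y < real j + 1"
    by (metis atLeastLessThan_iff not_le of_nat_Suc add.commute)
  then show "x \<in> {grid_point a b n j..<grid_point a b n (Suc j)} \<longleftrightarrow> j = i"
    using i by linarith
qed

text \<open>Fatou's lemma for the difference quotients over the uniform grids: they straddle the point
  \<open>x\<close>, hence converge to the derivative wherever it exists.\<close>

lemma deriv_L2_le_slope_energy:
  assumes "a < b" and L2: "deriv_in_L2 a b F" and "0 \<le> C"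
    and le: "\<And>n. 0 < n \<Longrightarrow> slope_energy a b F n \<le> C"
  shows "(LINT x:{a..b}|lebesgue. (deriv_Icc a b 1 F x)\<^sup>2) \<le> C"
proof -
  let ?p = "grid_point a b" and ?h = "deriv_Icc a b 1 F"
  define q where "q n j = ((F (?p n (Suc j)) - F (?p n j)) / ((b - a) / n))\<^sup>2" for n j
  \<comment> \<open>The squared slope of the interpolant as a step function, with integral
    \<open>slope_energy a b F n\<close>. Half-open cells leave exactly one nonzero indicator at each
    point of \<open>{a..<b}\<close>.\<close>
  define s where "s n x = (\<Sum>j<n. indicator {?p n j..<?p n (Suc j)} x * q n j)" for n x
  have s_eq: "s n x = q n (nat \<lfloor>(x - a) * real n / (b - a)\<rfloor>)" if "0 < n" "x \<in> {a..<b}" for n x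
  proof -
    have "s n x = (\<Sum>j<n. if j = nat \<lfloor>(x - a) * real n / (b - a)\<rfloor> then q n j else 0)"
      unfolding s_def using grid_index(2)[OF \<open>a < b\<close> that]
      by (intro sum.cong refl) (simp add: indicator_def del: atLeastLessThan_iff)
    then show ?thesis using grid_index(1)[OF \<open>a < b\<close> that] by simp
  qed
  have lim: "(\<lambda>n. s n x) \<longlonglongrightarrow> (?h x)\<^sup>2"
    if x: "x \<in> {a..<b}" and diff: "F differentiable (at x within {a..b})" for x
  proof -
    define i where "i n = nat \<lfloor>(x - a) * real n / (b - a)\<rfloor>" for n
    define r where "r n = (F (?p n (Suc (i n))) - F (?p n (i n))) / ((b - a) / n)" for n
    have xab: "x \<in> {a..b}" using x by auto
    have "r \<longlonglongrightarrow> ?h x"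
      unfolding LIMSEQ_iff
    proof (intro allI impI)
      fix \<epsilon> :: real assume "0 < \<epsilon>"
      \<comment> \<open>Half of \<open>\<epsilon>\<close> turns the non-strict bound obtained at the
        end into a strict one.\<close>
      then have "0 < \<epsilon> / 2" by simp
      then obtain d where "0 < d" and d: "\<forall>y\<in>{a..b}. norm (y - x) < d \<longrightarrow>
          norm (F y - F x - (y - x) *\<^sub>R ?h x) \<le> \<epsilon> / 2 * norm (y - x)"
        using has_vector_derivative_deriv_Icc[OF diff xab]
        unfolding has_vector_derivative_def has_derivative_within_alt by blast
      obtain n0 :: nat where n0: "(b - a) / d < n0" using reals_Archimedean2 by blast
      have "norm (r n - ?h x) < \<epsilon>" if "n0 \<le> n" for n
      proof -
        have "0 < (b - a) / d" using \<open>a < b\<close> \<open>0 < d\<close> by simp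
        then have "0 < n" "(b - a) / d < n" using n0 that by linarith+
        then have mesh: "(b - a) / n < d" "0 < (b - a) / n"
          using \<open>a < b\<close> \<open>0 < d\<close> by (auto simp: field_simps)
        let ?l = "?p n (i n)" and ?r = "?p n (Suc (i n))"
        have ir: "i n < n" "?l \<le> x" "x < ?r"
          using grid_index[OF \<open>a < b\<close> \<open>0 < n\<close> x] unfolding i_def by auto
        have ends: "?l \<in> {a..b}" "?r \<in> {a..b}"
          using ir(1) \<open>a < b\<close> \<open>0 < n\<close> by (auto intro!: grid_point_in_Icc simp del: atLeastAtMost_iff)
        have w: "?r = ?l + (b - a) / n" by (rule grid_point_Suc)
        have A: "\<bar>F ?l - F x - (?l - x) * ?h x\<bar> \<le> \<epsilon> / 2 * (x - ?l)"
        proof -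
          have "norm (?l - x) = x - ?l" "x - ?l < d" using ir mesh w by auto
          then show ?thesis using d[rule_format, OF ends(1)] by simp
        qed
        have B: "\<bar>F ?r - F x - (?r - x) * ?h x\<bar> \<le> \<epsilon> / 2 * (?r - x)"
        proof -
          have "norm (?r - x) = ?r - x" "?r - x < d" using ir mesh w by auto
          then show ?thesis using d[rule_format, OF ends(2)] by simp
        qed
        \<comment> \<open>Each error is proportional to the distance of an endpoint from
          \<open>x\<close>; as \<open>x\<close> lies inside the cell, these distances sum to the
          mesh width, which cancels in the quotient.\<close>
        have "\<bar>(F ?r - F ?l) - (b - a) / n * ?h x\<bar>
            = \<bar>(F ?r - F x - (?r - x) * ?h x) - (F ?l - F x - (?l - x) * ?h x)\<bar>"
          using w by (simp add: algebra_simps)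
        also have "\<dots> \<le> \<epsilon> / 2 * (x - ?l) + \<epsilon> / 2 * (?r - x)"
          using A B by linarith
        also have "\<dots> = \<epsilon> / 2 * ((b - a) / n)"
          using w by (simp add: algebra_simps)
        finally have "\<bar>(F ?r - F ?l) - (b - a) / n * ?h x\<bar> / ((b - a) / n) \<le> \<epsilon> / 2"
          by (simp only: pos_divide_le_eq[OF mesh(2)])
        moreover have "r n - ?h x = ((F ?r - F ?l) - (b - a) / n * ?h x) / ((b - a) / n)"
          using \<open>a < b\<close> \<open>0 < n\<close> by (simp add: r_def diff_divide_distrib)
        ultimately have "\<bar>r n - ?h x\<bar> \<le> \<epsilon> / 2"
          by (simp only: abs_divide[of _ "(b - a) / n"] abs_of_pos[OF mesh(2)])
        then show ?thesis using \<open>0 < \<epsilon>\<close> by simp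
      qed
      then show "\<exists>n0. \<forall>n\<ge>n0. norm (r n - ?h x) < \<epsilon>" by blast
    qed
    then have "(\<lambda>n. (r n)\<^sup>2) \<longlonglongrightarrow> (?h x)\<^sup>2" by (intro tendsto_intros)
    moreover have "\<forall>\<^sub>F n in sequentially. (r n)\<^sup>2 = s n x"
      using eventually_gt_at_top[of 0] by eventually_elim (simp add: s_eq[OF _ x] q_def r_def i_def)
    ultimately show ?thesis by (rule Lim_transform_eventually)
  qed
  have integral_s: "(\<integral>\<^sup>+x. ennreal (s n x) \<partial>lebesgue) \<le> ennreal C" if "0 < n" for n
  proof -
    have q: "0 \<le> q n j" for j by (simp add: q_def)
    have "(\<integral>\<^sup>+x. ennreal (s n x) \<partial>lebesgue)
        = (\<integral>\<^sup>+x. (\<Sum>j<n. ennreal (q n j) * indicator {?p n j..<?p n (Suc j)} x) \<partial>lebesgue)"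
      unfolding s_def using q
      by (intro nn_integral_cong)
        (auto simp: ennreal_mult' ennreal_indicator mult.commute simp flip: sum_ennreal)
    also have "\<dots> = (\<Sum>j<n. ennreal (q n j) * emeasure lebesgue {?p n j..<?p n (Suc j)})"
      by (subst nn_integral_sum) (auto simp: nn_integral_cmult_indicator intro!: measurable_completion)
    also have "\<dots> = (\<Sum>j<n. ennreal (q n j * ((b - a) / n)))"
      using q \<open>a < b\<close>
      by (intro sum.cong refl) (simp add: grid_point_Suc ennreal_mult' del: times_divide_eq_right)
    also have "\<dots> = ennreal (\<Sum>j<n. q n j * ((b - a) / n))"
      using q \<open>a < b\<close> by (intro sum_ennreal) simp
    also have "(\<Sum>j<n. q n j * ((b - a) / n)) = slope_energy a b F n"
    proof -
      have "(t / m)\<^sup>2 * m = t\<^sup>2 / m" if "m \<noteq> 0" for t m :: real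
        using that by (simp add: power2_eq_square)
      from this[of "(b - a) / n"] show ?thesis
        using \<open>a < b\<close> \<open>0 < n\<close> unfolding slope_energy_def q_def by (intro sum.cong refl) fastforce
    qed
    also have "ennreal (slope_energy a b F n) \<le> ennreal C"
      by (rule ennreal_leI[OF le[OF that]])
    finally show ?thesis .
  qed
  let ?f = "\<lambda>x. indicator {a..b} x *\<^sub>R (?h x)\<^sup>2"
  have int: "integrable lebesgue ?f"
    using L2 by (simp add: deriv_in_L2_def set_integrable_def)
  \<comment> \<open>No half-open cell contains \<open>b\<close>, so \<open>s n b\<close> does not
    approximate the derivative there; a single point is discarded.\<close>
  have "AE x in lebesgue. x \<noteq> b"
    using AE_completion[OF AE_lborel_singleton[of b]] .
  moreover have "AE x in lebesgue. x \<in> {a..b} \<longrightarrow> F differentiable (at x within {a..b})"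
    using L2 by (simp add: deriv_in_L2_def)
  ultimately have ae: "AE x in lebesgue. ennreal (?f x) \<le> liminf (\<lambda>n. ennreal (s n x))"
  proof eventually_elim
    case (elim x)
    show ?case
    proof (cases "x \<in> {a..b}")
      case True
      then have "(\<lambda>n. ennreal (s n x)) \<longlonglongrightarrow> ennreal (?f x)"
        using elim lim[of x] by (intro tendsto_ennrealI) auto
      then show ?thesis by (simp add: lim_imp_Liminf)
    qed simp
  qed
  have "ennreal (integral\<^sup>L lebesgue ?f) = (\<integral>\<^sup>+x. ennreal (?f x) \<partial>lebesgue)"
    by (rule nn_integral_eq_integral[OF int, symmetric]) simp
  also have "\<dots> \<le> (\<integral>\<^sup>+x. liminf (\<lambda>n. ennreal (s n x)) \<partial>lebesgue)"
    by (rule nn_integral_mono_AE[OF ae])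
  also have "\<dots> \<le> liminf (\<lambda>n. \<integral>\<^sup>+x. ennreal (s n x) \<partial>lebesgue)"
    unfolding s_def by (intro nn_integral_liminf measurable_completion) measurable
  also have "\<dots> \<le> liminf (\<lambda>n. ennreal C)"
    using integral_s by (intro Liminf_mono eventually_mono[OF eventually_gt_at_top[of 0]])
  also have "\<dots> = ennreal C"
    by (simp add: Liminf_const)
  finally show ?thesis
    using \<open>0 \<le> C\<close> by (simp add: set_lebesgue_integral_def ennreal_le_iff)
qed

section \<open>The space W26\<close>

lemma deriv_Icc_outside:
  assumes "zero_outside a b u" "x \<notin> {a..b}"
  shows "deriv_Icc a b i u x = 0"
proof (cases i)
  case 0
  then show ?thesis using assms by (simp add: zero_outside_def)
next
  case (Suc j)
  then show ?thesis using assms(2) by (simp only: deriv_Icc_Suc deriv_Icc_1 if_False)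
qed

lemma deriv_Icc_zero:
  assumes "a < b"
  shows "deriv_Icc a b i (\<lambda>t. 0) = (\<lambda>t. 0)"
proof (induction i)
  case (Suc i)
  have "deriv_Icc a b 1 (\<lambda>t. 0) x = 0" for x
    using deriv_Icc_eq[OF assms _ has_vector_derivative_const, of x 0] deriv_Icc_1[of a b _ x] by metis
  then show ?case using Suc by (simp only: deriv_Icc_Suc)
qed simp

section \<open>Closure properties of absolute continuity and of square integrable
  derivatives\<close>

lemma deriv_in_L2_cong:
  assumes "deriv_in_L2 a b p" "\<And>x. x \<in> {a..b} \<Longrightarrow> q x = p x"
  shows "deriv_in_L2 a b q"
proof -
  have hvd: "(q has_vector_derivative y) (at x within {a..b}) \<longleftrightarrow> (p has_vector_derivative y) (at x within {a..b})"
    if "x \<in> {a..b}" for x y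
    using that assms(2) has_vector_derivative_transform[of x "{a..b}" p q y]
      has_vector_derivative_transform[of x "{a..b}" q p y] by auto
  have "deriv_Icc a b 1 q = deriv_Icc a b 1 p"
    unfolding fun_eq_iff deriv_Icc_1 vector_derivative_def using hvd by auto
  moreover have "q differentiable (at x within {a..b})"
    if "x \<in> {a..b}" "p differentiable (at x within {a..b})" for x
    using hvd[OF that(1)] that(2) differentiableI_vector vector_derivative_works by blast
  ultimately show ?thesis
    using assms(1) unfolding deriv_in_L2_iff by (auto elim: eventually_mono)
qed

text \<open>Off the union of the two exceptional null sets the derivative is linear. On it
  \<open>deriv_Icc\<close> need not be, hence the almost-everywhere form of the second
  claim.\<close>

lemma
  assumes "a < b" "deriv_in_L2 a b p" "deriv_in_L2 a b q"
  shows deriv_in_L2_add_scale: "deriv_in_L2 a b (\<lambda>t. p t + c * q t)" (is ?th)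
    and AE_deriv_add_scale: "AE x in lebesgue. x \<in> {a..b} \<longrightarrow>
      deriv_Icc a b 1 (\<lambda>t. p t + c * q t) x = deriv_Icc a b 1 p x + c * deriv_Icc a b 1 q x"
proof -
  let ?d = "\<lambda>u x. x \<in> {a..b} \<longrightarrow> u differentiable (at x within {a..b})"
  have ae: "AE x in lebesgue. ?d p x" "AE x in lebesgue. ?d q x"
    and sq: "sq_integrable lebesgue {a..b} (deriv_Icc a b 1 p)" "sq_integrable lebesgue {a..b} (deriv_Icc a b 1 q)"
    using assms by (auto simp: deriv_in_L2_iff)
  have hvd: "((\<lambda>t. p t + c * q t) has_vector_derivative deriv_Icc a b 1 p x + c * deriv_Icc a b 1 q x) (at x within {a..b})"
    if "x \<in> {a..b}" "?d p x" "?d q x" for x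
    using that by (intro has_vector_derivative_add has_vector_derivative_mult_right has_vector_derivative_deriv_Icc) auto
  show AE: "AE x in lebesgue. x \<in> {a..b} \<longrightarrow>
      deriv_Icc a b 1 (\<lambda>t. p t + c * q t) x = deriv_Icc a b 1 p x + c * deriv_Icc a b 1 q x"
    using ae by eventually_elim (use hvd deriv_Icc_eq[OF \<open>a < b\<close>] in blast)
  have "AE x in lebesgue. ?d (\<lambda>t. p t + c * q t) x"
    using ae by eventually_elim (use hvd differentiableI_vector in blast)
  then show ?th
    using sq_integrable_AE_cong[OF sq_integrable_add_scale[OF sq] AE] by (simp add: deriv_in_L2_iff)
qed

text \<open>The product rule gives a continuous term plus a continuous multiple of an L^2 function.
  It is meant for the product of the coefficient \<open>f\<close> with the limit function, which is
  continuously differentiable.\<close>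

lemma deriv_in_L2_times:
  assumes "a < b" and p: "deriv_in_L2 a b p" "continuous_on {a..b} p"
    and q: "\<And>x. x \<in> {a..b} \<Longrightarrow> (q has_vector_derivative q' x) (at x within {a..b})" "continuous_on {a..b} q'"
  shows "deriv_in_L2 a b (\<lambda>t. p t * q t)"
proof -
  have ae: "AE x in lebesgue. x \<in> {a..b} \<longrightarrow> p differentiable (at x within {a..b})"
    and sq: "sq_integrable lebesgue {a..b} (deriv_Icc a b 1 p)"
    using p by (auto simp: deriv_in_L2_iff)
  have cq: "continuous_on {a..b} q"
    by (rule continuous_on_vector_derivative[OF q(1)])
  have hvd: "((\<lambda>t. p t * q t) has_vector_derivative p x * q' x + deriv_Icc a b 1 p x * q x) (at x within {a..b})"
    if "x \<in> {a..b}" "p differentiable (at x within {a..b})" for x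
    using that by (intro has_vector_derivative_mult has_vector_derivative_deriv_Icc q)
  \<comment> \<open>The factor 1 puts the right side into the shape of
    \<open>sq_integrable_add_scale\<close>.\<close>
  have AE: "AE x in lebesgue. x \<in> {a..b} \<longrightarrow>
      deriv_Icc a b 1 (\<lambda>t. p t * q t) x = p x * q' x + 1 * (q x * deriv_Icc a b 1 p x)"
    using ae by eventually_elim (use deriv_Icc_eq[OF \<open>a < b\<close> _ hvd] in \<open>auto simp: mult.commute\<close>)
  have "AE x in lebesgue. x \<in> {a..b} \<longrightarrow> (\<lambda>t. p t * q t) differentiable (at x within {a..b})"
    using ae by eventually_elim (use hvd differentiableI_vector in blast)
  moreover have "sq_integrable lebesgue {a..b} (deriv_Icc a b 1 (\<lambda>t. p t * q t))"
    by (rule sq_integrable_AE_cong[OF sq_integrable_add_scale AE])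
      (intro sq_integrable_continuous_on sq_integrable_continuous_times continuous_on_mult p q cq sq)+
  ultimately show ?thesis by (simp add: deriv_in_L2_iff)
qed

text \<open>Both factors are continuous, hence bounded on the compact interval, so an increment of
  the product is dominated by the increments of the factors.\<close>

lemma abs_cont_Icc_times:
  assumes "abs_cont_Icc a b p" "abs_cont_Icc a b q"
  shows "abs_cont_Icc a b (\<lambda>t. p t * q t)"
proof -
  have "\<exists>B. \<forall>x\<in>{a..b}. \<bar>h x\<bar> \<le> B" if "abs_cont_Icc a b h" for h
  proof -
    have "bounded (h ` {a..b})"
      by (rule compact_imp_bounded[OF compact_continuous_image[OF abs_cont_Icc_continuous_on[OF that]]]) simp
    then show ?thesis unfolding bounded_iff by auto
  qed
  then obtain P Q where P: "\<And>x. x \<in> {a..b} \<Longrightarrow> \<bar>p x\<bar> \<le> P" and Q: "\<And>x. x \<in> {a..b} \<Longrightarrow> \<bar>q x\<bar> \<le> Q"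
    using assms by meson
  show ?thesis
  proof (rule abs_cont_Icc_dominated[OF assms])
    fix x y assume xy: "x \<in> {a..b}" "y \<in> {a..b}"
    have "p y * q y - p x * q x = q y * (p y - p x) + p x * (q y - q x)"
      by (simp add: algebra_simps)
    then have "\<bar>p y * q y - p x * q x\<bar> \<le> \<bar>q y\<bar> * \<bar>p y - p x\<bar> + \<bar>p x\<bar> * \<bar>q y - q x\<bar>"
      by (metis abs_mult abs_triangle_ineq)
    also have "\<dots> \<le> (P + Q) * \<bar>p y - p x\<bar> + (P + Q) * \<bar>q y - q x\<bar>"
      using P[OF xy(1)] P[OF xy(2)] Q[OF xy(1)] Q[OF xy(2)] by (intro add_mono mult_right_mono) auto
    finally show "\<bar>p y * q y - p x * q x\<bar> \<le> (P + Q) * (\<bar>p y - p x\<bar> + \<bar>q y - q x\<bar>)"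
      by (simp add: algebra_simps)
  qed
qed

lemma abs_cont_Icc_add_scale:
  assumes "abs_cont_Icc a b p" "abs_cont_Icc a b q"
  shows "abs_cont_Icc a b (\<lambda>t. p t + c * q t)"
proof (rule abs_cont_Icc_dominated[OF assms])
  fix x y
  have "p y + c * q y - (p x + c * q x) = (p y - p x) + c * (q y - q x)"
    by (simp add: algebra_simps)
  then have "\<bar>p y + c * q y - (p x + c * q x)\<bar> \<le> \<bar>p y - p x\<bar> + \<bar>c\<bar> * \<bar>q y - q x\<bar>"
    by (metis abs_mult abs_triangle_ineq)
  also have "\<dots> \<le> (1 + \<bar>c\<bar>) * \<bar>p y - p x\<bar> + (1 + \<bar>c\<bar>) * \<bar>q y - q x\<bar>"
    by (intro add_mono mult_right_mono mult_right_le_one_le) (auto simp: mult_le_cancel_right1)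
  finally show "\<bar>p y + c * q y - (p x + c * q x)\<bar> \<le> (1 + \<bar>c\<bar>) * (\<bar>p y - p x\<bar> + \<bar>q y - q x\<bar>)"
    by (simp add: algebra_simps)
qed

lemma abs_cont_Icc_C1:
  assumes der: "\<And>x. x \<in> {a..b} \<Longrightarrow> (h has_vector_derivative h' x) (at x within {a..b})"
    and "continuous_on {a..b} h'"
  shows "abs_cont_Icc a b h"
proof -
  have "bounded (h' ` {a..b})"
    by (rule compact_imp_bounded[OF compact_continuous_image[OF assms(2)]]) simp
  then obtain B where "\<forall>y\<in>h' ` {a..b}. norm y \<le> B"
    unfolding bounded_iff by blast
  then have B: "norm (h' x) \<le> B" if "x \<in> {a..b}" for x
    using that by simp
  show ?thesis
  proof (rule abs_cont_Icc_lipschitz)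
    fix x y assume "x \<in> {a..b}" "y \<in> {a..b}"
    then show "\<bar>h y - h x\<bar> \<le> B * \<bar>y - x\<bar>"
      using field_differentiable_bound[of "{a..b}" h h' B y x] der B
      by (simp add: has_real_derivative_iff_has_vector_derivative)
  qed
qed

section \<open>The linear structure of \<open>W26\<close>, its inner product and its sup
  bounds\<close>

lemma W26_D:
  assumes "u \<in> W26 a b"
  shows "zero_outside a b u"
    and "i < 5 \<Longrightarrow> x \<in> {a..b} \<Longrightarrow>
      (deriv_Icc a b i u has_vector_derivative deriv_Icc a b (Suc i) u x) (at x within {a..b})"
    and "i \<le> 5 \<Longrightarrow> abs_cont_Icc a b (deriv_Icc a b i u)"
    and "deriv_in_L2 a b (deriv_Icc a b 5 u)"
    and "u a = 0" "deriv_Icc a b 1 u a = 0" "deriv_Icc a b 2 u a = 0" "u b = 0" "deriv_Icc a b 1 u b = 0"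
  using assms
  by (auto simp: W26_def deriv_Icc_Suc differentiable_on_def simp del: One_nat_def
      intro!: has_vector_derivative_deriv_Icc)

lemma W26_I:
  assumes "zero_outside a b u"
    and "\<And>i x. i < 5 \<Longrightarrow> x \<in> {a..b} \<Longrightarrow>
      (deriv_Icc a b i u has_vector_derivative d i x) (at x within {a..b})"
    and "\<And>i. i \<le> 5 \<Longrightarrow> abs_cont_Icc a b (deriv_Icc a b i u)"
    and "deriv_in_L2 a b (deriv_Icc a b 5 u)"
    and "u a = 0" "deriv_Icc a b 1 u a = 0" "deriv_Icc a b 2 u a = 0" "u b = 0" "deriv_Icc a b 1 u b = 0"
  shows "u \<in> W26 a b"
proof -
  have "deriv_Icc a b i u differentiable_on {a..b}" if "i < 5" for i
    unfolding differentiable_on_def using assms(2)[OF that] differentiableI_vector by blast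
  then show ?thesis unfolding W26_def using assms by simp
qed

text \<open>Order 5 is the limit of exact linearity: the derivatives of order below 5 are
  differentiable at every point, whereas the fifth is so only almost everywhere.\<close>

lemma deriv_Icc_add_scale:
  assumes "a < b" and uv: "u \<in> W26 a b" "v \<in> W26 a b" and "i \<le> 5"
  shows "deriv_Icc a b i (\<lambda>t. u t + c * v t) = (\<lambda>t. deriv_Icc a b i u t + c * deriv_Icc a b i v t)"
  using \<open>i \<le> 5\<close>
proof (induction i)
  case (Suc i)
  show ?case
  proof
    fix x
    show "deriv_Icc a b (Suc i) (\<lambda>t. u t + c * v t) x = deriv_Icc a b (Suc i) u x + c * deriv_Icc a b (Suc i) v x"
    proof (cases "x \<in> {a..b}")
      case True
      have "((\<lambda>t. deriv_Icc a b i u t + c * deriv_Icc a b i v t) has_vector_derivative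
          deriv_Icc a b (Suc i) u x + c * deriv_Icc a b (Suc i) v x) (at x within {a..b})"
        using Suc.prems True
        by (intro has_vector_derivative_add has_vector_derivative_mult_right W26_D(2)[OF uv(1)] W26_D(2)[OF uv(2)]) auto
      then show ?thesis
        using Suc deriv_Icc_eq[OF \<open>a < b\<close> True] by (simp only: deriv_Icc_Suc[of _ _ i "\<lambda>t. u t + c * v t"] Suc_leD)
    next
      case False
      then show ?thesis by (simp only: deriv_Icc_Suc deriv_Icc_1 if_False)
    qed
  qed
qed simp

lemma W26_add_scale:
  assumes "a < b" and uv: "u \<in> W26 a b" "v \<in> W26 a b"
  shows "(\<lambda>t. u t + c * v t) \<in> W26 a b"
proof -
  note D = deriv_Icc_add_scale[OF assms]
  have "zero_outside a b (\<lambda>t. u t + c * v t)"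
    using W26_D(1)[OF uv(1)] W26_D(1)[OF uv(2)] by (simp add: zero_outside_def)
  moreover have "(deriv_Icc a b i (\<lambda>t. u t + c * v t) has_vector_derivative
      deriv_Icc a b (Suc i) u x + c * deriv_Icc a b (Suc i) v x) (at x within {a..b})"
    if "i < 5" "x \<in> {a..b}" for i x
    using that D[of i]
    by (auto intro!: has_vector_derivative_add has_vector_derivative_mult_right W26_D(2)[OF uv(1)] W26_D(2)[OF uv(2)])
  moreover have "abs_cont_Icc a b (deriv_Icc a b i (\<lambda>t. u t + c * v t))" if "i \<le> 5" for i
    using that D[of i] by (auto intro!: abs_cont_Icc_add_scale W26_D(3)[OF uv(1)] W26_D(3)[OF uv(2)])
  moreover have "deriv_in_L2 a b (deriv_Icc a b 5 (\<lambda>t. u t + c * v t))"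
    using D[of 5] by (auto intro!: deriv_in_L2_add_scale assms W26_D(4))
  ultimately show ?thesis
    using D[of 1] D[of 2] W26_D(5-9)[OF uv(1)] W26_D(5-9)[OF uv(2)]
    by (intro W26_I[where d = "\<lambda>i x. deriv_Icc a b (Suc i) u x + c * deriv_Icc a b (Suc i) v x"]) auto
qed

lemma W26_zero:
  assumes "a < b"
  shows "(\<lambda>t. 0) \<in> W26 a b"
proof (rule W26_I[where d = "\<lambda>i x. 0"])
  show "deriv_in_L2 a b (deriv_Icc a b 5 (\<lambda>t. 0))"
    using deriv_Icc_zero[OF assms, of 1]
    by (simp add: deriv_in_L2_def deriv_Icc_zero set_borel_measurable_def set_integrable_def assms)
qed (auto simp: deriv_Icc_zero assms zero_outside_def intro!: abs_cont_Icc_lipschitz[where C = 0])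

lemma sq_integrable_deriv6: "u \<in> W26 a b \<Longrightarrow> sq_integrable lebesgue {a..b} (deriv_Icc a b 6 u)"
  using W26_D(4)[of u a b] deriv_Icc_Suc[of a b 5 u] by (simp add: deriv_in_L2_iff)

lemma AE_deriv6_add_scale:
  assumes "a < b" "u \<in> W26 a b" "v \<in> W26 a b"
  shows "AE x in lebesgue. x \<in> {a..b} \<longrightarrow>
    deriv_Icc a b 6 (\<lambda>t. u t + c * v t) x = deriv_Icc a b 6 u x + c * deriv_Icc a b 6 v x"
  using AE_deriv_add_scale[OF assms(1) W26_D(4)[OF assms(2)] W26_D(4)[OF assms(3)], of c]
    deriv_Icc_add_scale[OF assms, of 5 c] deriv_Icc_Suc[of a b 5] by simp

lemma semi_inner_product_W26:
  assumes "a < b"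
  shows "semi_inner_product (W26 a b) (inner_W26 a b)"
proof -
  interpret L2: semi_inner_product "{h. sq_integrable lebesgue {a..b} h}"
      "\<lambda>p q. LINT x:{a..b}|lebesgue. p x * q x"
    by (rule semi_inner_product_sq_integrable)
  show ?thesis
  proof
    show "(\<lambda>t. 0) \<in> W26 a b" by (rule W26_zero[OF assms])
  next
    fix u v c assume "u \<in> W26 a b" "v \<in> W26 a b"
    then show "(\<lambda>t. u t + c * v t) \<in> W26 a b" by (rule W26_add_scale[OF assms])
  next
    fix u v w c assume m: "u \<in> W26 a b" "v \<in> W26 a b" "w \<in> W26 a b"
    let ?d = "deriv_Icc a b"
    let ?s = "\<lambda>t. u t + c * v t"
    note s = W26_add_scale[OF assms m(1,2), of c]
    have sum: "(\<Sum>i\<le>5. ?d i ?s a * ?d i w a) = (\<Sum>i\<le>5. ?d i u a * ?d i w a) + c * (\<Sum>i\<le>5. ?d i v a * ?d i w a)"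
    proof -
      have "(\<Sum>i\<le>5. ?d i ?s a * ?d i w a) = (\<Sum>i\<le>5. ?d i u a * ?d i w a + c * (?d i v a * ?d i w a))"
        using deriv_Icc_add_scale[OF assms m(1,2)] by (intro sum.cong refl) (simp add: algebra_simps)
      then show ?thesis by (simp only: sum.distrib sum_distrib_left)
    qed
    \<comment> \<open>The sixth derivative is linear only almost everywhere, so it has to be split
      under the integral.\<close>
    have "(LINT x:{a..b}|lebesgue. ?d 6 ?s x * ?d 6 w x)
        = (LINT x:{a..b}|lebesgue. (?d 6 u x + c * ?d 6 v x) * ?d 6 w x)"
      unfolding set_lebesgue_integral_def
    proof (rule integral_cong_AE)
      have meas: "set_integrable lebesgue {a..b} (\<lambda>x. ?d 6 ?s x * ?d 6 w x)"
        "set_integrable lebesgue {a..b} (\<lambda>x. (?d 6 u x + c * ?d 6 v x) * ?d 6 w x)"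
        using m s by (auto intro!: sq_integrable_times sq_integrable_add_scale sq_integrable_deriv6)
      show "(\<lambda>x. indicator {a..b} x *\<^sub>R (?d 6 ?s x * ?d 6 w x)) \<in> borel_measurable lebesgue"
        "(\<lambda>x. indicator {a..b} x *\<^sub>R ((?d 6 u x + c * ?d 6 v x) * ?d 6 w x)) \<in> borel_measurable lebesgue"
        using meas unfolding set_integrable_def by (auto dest: borel_measurable_integrable)
      show "AE x in lebesgue. indicator {a..b} x *\<^sub>R (?d 6 ?s x * ?d 6 w x)
          = indicator {a..b} x *\<^sub>R ((?d 6 u x + c * ?d 6 v x) * ?d 6 w x)"
        using AE_deriv6_add_scale[OF assms m(1,2), of c] by eventually_elim (auto simp: indicator_def)
    qed
    also have "\<dots> = (LINT x:{a..b}|lebesgue. ?d 6 u x * ?d 6 w x) + c * (LINT x:{a..b}|lebesgue. ?d 6 v x * ?d 6 w x)"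
      using m by (intro L2.add_scale_left) (auto intro: sq_integrable_deriv6)
    finally have int: "(LINT x:{a..b}|lebesgue. ?d 6 ?s x * ?d 6 w x)
        = (LINT x:{a..b}|lebesgue. ?d 6 u x * ?d 6 w x) + c * (LINT x:{a..b}|lebesgue. ?d 6 v x * ?d 6 w x)" .
    show "inner_W26 a b ?s w = inner_W26 a b u w + c * inner_W26 a b v w"
      unfolding inner_W26_def sum int by (simp add: algebra_simps)
  next
    fix u v show "inner_W26 a b u v = inner_W26 a b v u"
      by (simp add: inner_W26_def mult.commute)
  next
    fix u assume "u \<in> W26 a b"
    then show "0 \<le> inner_W26 a b u u"
      unfolding inner_W26_def using L2.nonneg[of "deriv_Icc a b 6 u"]
      by (auto intro!: add_nonneg_nonneg sum_nonneg sq_integrable_deriv6)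
  qed
qed

lemma
  assumes "a < b" "v \<in> W26 a b"
  shows deriv_at_a_le_inner_W26: "i \<le> 5 \<Longrightarrow> (deriv_Icc a b i v a)\<^sup>2 \<le> inner_W26 a b v v"
    and integral_deriv6_le_inner_W26: "(LINT x:{a..b}|lebesgue. (deriv_Icc a b 6 v x)\<^sup>2) \<le> inner_W26 a b v v"
    and inner_W26_nonneg: "0 \<le> inner_W26 a b v v"
proof -
  have "0 \<le> (LINT x:{a..b}|lebesgue. (deriv_Icc a b 6 v x)\<^sup>2)"
    unfolding set_lebesgue_integral_def by (intro integral_nonneg_AE) auto
  moreover have "(deriv_Icc a b i v a)\<^sup>2 \<le> (\<Sum>i\<le>5. (deriv_Icc a b i v a)\<^sup>2)" if "i \<le> 5" for i
    using that by (intro member_le_sum) auto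
  moreover have "0 \<le> (\<Sum>i\<le>5. (deriv_Icc a b i v a)\<^sup>2)"
    by (intro sum_nonneg) auto
  ultimately show "i \<le> 5 \<Longrightarrow> (deriv_Icc a b i v a)\<^sup>2 \<le> inner_W26 a b v v"
    "(LINT x:{a..b}|lebesgue. (deriv_Icc a b 6 v x)\<^sup>2) \<le> inner_W26 a b v v" "0 \<le> inner_W26 a b v v"
    unfolding inner_W26_def power2_eq_square[symmetric] by (fastforce intro: add_increasing2)+
qed

text \<open>Descending induction on the order. At order 5 the value at \<open>a\<close> and the
  increment bound give the constant 1 + sqrt (b - a); below, the mean value inequality started at
  \<open>a\<close> turns \<open>C\<close> into 1 + C (b - a). Since the constant does not depend on
  \<open>v\<close>, norm-Cauchy sequences have uniformly convergent derivatives up to order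
  five.\<close>

lemma W26_sup_bound:
  assumes "a < b" "i \<le> 5"
  shows "\<exists>C. \<forall>v\<in>W26 a b. \<forall>x\<in>{a..b}. \<bar>deriv_Icc a b i v x\<bar> \<le> C * norm_W26 a b v"
  using \<open>i \<le> 5\<close>
proof (induction i rule: inc_induct)
  case base
  have "\<bar>deriv_Icc a b 5 v x\<bar> \<le> (1 + sqrt (b - a)) * norm_W26 a b v"
    if v: "v \<in> W26 a b" and x: "x \<in> {a..b}" for v x
  proof -
    let ?u = "deriv_Icc a b 5 v" and ?g = "\<lambda>x. (deriv_Icc a b 6 v x)\<^sup>2"
    have 6: "deriv_Icc a b 1 ?u = deriv_Icc a b 6 v" using deriv_Icc_Suc[of a b 5 v] by simp
    have int: "?g absolutely_integrable_on {a..b}"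
      using sq_integrable_deriv6[OF v] by (simp add: sq_integrable_def)
    have int': "?g absolutely_integrable_on {a..x}"
      by (rule set_integrable_subset[OF int]) (use x in auto)
    have "(LINT t:{a..x}|lebesgue. ?g t) \<le> (LINT t:{a..b}|lebesgue. ?g t)"
      using x int int' by (simp add: set_lebesgue_integral_eq_integral integral_subset_le)
    then have mono: "(LINT t:{a..x}|lebesgue. ?g t) \<le> inner_W26 a b v v"
      using integral_deriv6_le_inner_W26[OF \<open>a < b\<close> v] by simp
    have "(?u x - ?u a)\<^sup>2 \<le> (x - a) * (LINT t:{a..x}|lebesgue. ?g t)"
      using abs_cont_Icc_increment[OF W26_D(3)[OF v order_refl] W26_D(4)[OF v], of a x] x by (simp only: 6) simp
    also have "\<dots> \<le> (b - a) * inner_W26 a b v v"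
      using x mono inner_W26_nonneg[OF \<open>a < b\<close> v] by (intro mult_mono') (auto simp: set_lebesgue_integral_def intro!: integral_nonneg_AE)
    finally have "sqrt ((?u x - ?u a)\<^sup>2) \<le> sqrt ((b - a) * inner_W26 a b v v)"
      by (rule real_sqrt_le_mono)
    then have "\<bar>?u x - ?u a\<bar> \<le> sqrt (b - a) * norm_W26 a b v"
      by (simp add: norm_W26_def real_sqrt_mult)
    moreover have "\<bar>?u a\<bar> \<le> norm_W26 a b v"
      using real_sqrt_le_mono[OF deriv_at_a_le_inner_W26[OF \<open>a < b\<close> v, of 5]] by (simp add: norm_W26_def)
    ultimately show ?thesis by (simp add: algebra_simps)
  qed
  then show ?case by blast
next
  case (step i)
  then obtain C where C: "\<And>v x. v \<in> W26 a b \<Longrightarrow> x \<in> {a..b} \<Longrightarrow> \<bar>deriv_Icc a b (Suc i) v x\<bar> \<le> C * norm_W26 a b v"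
    by blast
  have "\<bar>deriv_Icc a b i v x\<bar> \<le> (1 + C * (b - a)) * norm_W26 a b v"
    if v: "v \<in> W26 a b" and x: "x \<in> {a..b}" for v x
  proof -
    let ?u = "deriv_Icc a b i v"
    \<comment> \<open>The sign of \<open>C\<close> is unknown, but the product is nonnegative
      because it bounds an absolute value.\<close>
    have Cn: "0 \<le> C * norm_W26 a b v" using C[OF v x] by linarith
    have "norm (?u x - ?u a) \<le> C * norm_W26 a b v * norm (x - a)"
      using C[OF v] W26_D(2)[OF v \<open>i < 5\<close>] x \<open>a < b\<close>
      by (intro field_differentiable_bound[of "{a..b}" _ "deriv_Icc a b (Suc i) v"])
        (auto simp: has_real_derivative_iff_has_vector_derivative)
    also have "\<dots> \<le> C * norm_W26 a b v * (b - a)"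
      using x Cn by (intro mult_left_mono) auto
    finally have "\<bar>?u x - ?u a\<bar> \<le> C * norm_W26 a b v * (b - a)" by simp
    moreover have "\<bar>?u a\<bar> \<le> norm_W26 a b v"
      using real_sqrt_le_mono[OF deriv_at_a_le_inner_W26[OF \<open>a < b\<close> v, of i]] \<open>i < 5\<close> by (simp add: norm_W26_def)
    ultimately have "\<bar>?u x\<bar> \<le> norm_W26 a b v + C * norm_W26 a b v * (b - a)" by linarith
    then show ?thesis by (simp add: algebra_simps)
  qed
  then show ?case by blast
qed

section \<open>Convergence\<close>

text \<open>Stated for an arbitrary sequence, so that Gram-Schmidt enters only through
  \<open>Cauchy\<close> and \<open>L\<close>. For each n, \<open>L\<close> asks for zeros at the
  first n nodes only, which is what orthogonality to n generators provides.\<close>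

lemma W26_Cauchy_limit_zero:
  fixes R :: "nat \<Rightarrow> real \<Rightarrow> real"
  assumes "a < b" and f: "abs_cont_Icc a b f" "deriv_in_L2 a b f"
    and inj: "inj_on (op_L a b f) (W26 a b)"
    and R: "\<And>n. R n \<in> W26 a b"
    and Cauchy: "\<And>\<epsilon>. 0 < \<epsilon> \<Longrightarrow>
      \<exists>N. \<forall>m\<ge>N. \<forall>n\<ge>m. inner_W26 a b (\<lambda>t. R m t - R n t) (\<lambda>t. R m t - R n t) < \<epsilon>"
    and x: "range x \<subseteq> {a..b}" "{a..b} \<subseteq> closure (range x)"
    and L: "\<And>k n. k < n \<Longrightarrow> op_L a b f (R n) (x k) = 0"
  shows "(\<lambda>n. inner_W26 a b (R n) (R n)) \<longlonglongrightarrow> 0"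
proof -
  interpret W: semi_inner_product "W26 a b" "inner_W26 a b"
    by (rule semi_inner_product_W26[OF \<open>a < b\<close>])
  let ?D = "deriv_Icc a b"
  \<comment> \<open>\<open>lim\<close> yields total functions before any convergence is known;
    outside the interval all terms are 0, so the limits represent functions extended by
    zero.\<close>
  define \<rho> where "\<rho> i t = lim (\<lambda>n. ?D i (R n) t)" for i t
  have diff: "(\<lambda>t. R m t - R n t) \<in> W26 a b" for m n
    by (rule W.diff_mem[OF R R])
  have D_diff: "?D i (\<lambda>t. R m t - R n t) = (\<lambda>t. ?D i (R m) t - ?D i (R n) t)" if "i \<le> 5" for i m n
    using deriv_Icc_add_scale[OF \<open>a < b\<close> R R that, of m "-1" n] by simp
  have ul: "uniform_limit {a..b} (\<lambda>n. ?D i (R n)) (\<rho> i) sequentially" if i: "i \<le> 5" for i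
  proof -
    obtain C where C: "\<And>v t. v \<in> W26 a b \<Longrightarrow> t \<in> {a..b} \<Longrightarrow> \<bar>?D i v t\<bar> \<le> C * norm_W26 a b v"
      using W26_sup_bound[OF \<open>a < b\<close> i] by blast
    have "uniformly_Cauchy_on {a..b} (\<lambda>n. ?D i (R n))"
    proof (rule uniformly_Cauchy_onI')
      fix \<epsilon> :: real assume "0 < \<epsilon>"
      \<comment> \<open>The summand 1 covers \<open>C = 0\<close>. The square of
        \<open>\<delta>\<close> is used below because the Cauchy hypothesis speaks of squared
        norms.\<close>
      define \<delta> where "\<delta> = \<epsilon> / (\<bar>C\<bar> + 1)"
      have \<delta>: "0 < \<delta>" "\<bar>C\<bar> * \<delta> < \<epsilon>" using \<open>0 < \<epsilon>\<close> by (auto simp: \<delta>_def field_simps)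
      obtain N where N: "\<And>m n. N \<le> m \<Longrightarrow> m \<le> n \<Longrightarrow>
          inner_W26 a b (\<lambda>t. R m t - R n t) (\<lambda>t. R m t - R n t) < \<delta>\<^sup>2"
        using Cauchy[of "\<delta>\<^sup>2"] \<delta>(1) by auto
      have "dist (?D i (R m) t) (?D i (R n) t) < \<epsilon>" if mn: "N \<le> m" "m < n" and t: "t \<in> {a..b}" for m n t
      proof -
        have "norm_W26 a b (\<lambda>t. R m t - R n t) \<le> \<delta>"
          unfolding norm_W26_def using N[of m n] mn \<delta>(1) by (intro real_le_lsqrt) auto
        moreover have "0 \<le> norm_W26 a b (\<lambda>t. R m t - R n t)"
          unfolding norm_W26_def using W.nonneg[OF diff] by simp
        ultimately have "C * norm_W26 a b (\<lambda>t. R m t - R n t) \<le> \<bar>C\<bar> * \<delta>"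
          by (intro mult_mono) auto
        then have "\<bar>?D i (\<lambda>t. R m t - R n t) t\<bar> < \<epsilon>"
          using C[OF diff t, of m n] \<delta>(2) by linarith
        then show ?thesis using D_diff[OF \<open>i \<le> 5\<close>] by (simp add: dist_real_def)
      qed
      then show "\<exists>M. \<forall>t\<in>{a..b}. \<forall>m\<ge>M. \<forall>n>m. dist (?D i (R m) t) (?D i (R n) t) < \<epsilon>"
        by blast
    qed
    then show ?thesis
      using Cauchy_uniformly_convergent unfolding uniformly_convergent_uniform_limit_iff \<rho>_def by blast
  qed
  have lim: "(\<lambda>n. ?D i (R n) t) \<longlonglongrightarrow> \<rho> i t" if "i \<le> 5" "t \<in> {a..b}" for i t
    by (rule tendsto_uniform_limitI[OF ul that(2)]) (rule that(1))
  have outside: "\<rho> i t = 0" if "t \<notin> {a..b}" for i t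
    using deriv_Icc_outside[OF W26_D(1)[OF R] that] by (simp add: \<rho>_def)
  have cont: "continuous_on {a..b} (\<rho> i)" if "i \<le> 5" for i
    using uniform_limit_theorem[OF always_eventually ul[OF that]]
      abs_cont_Icc_continuous_on[OF W26_D(3)[OF R that]] by auto
  have der: "(\<rho> i has_vector_derivative \<rho> (Suc i) t) (at t within {a..b})" if "i < 5" "t \<in> {a..b}" for i t
  proof -
    \<comment> \<open>Termwise differentiation: uniform convergence of the derivatives and
      convergence at one point yield some limit \<open>g\<close>, identified with
      \<open>\<rho> i\<close> afterwards by uniqueness of limits.\<close>
    have "\<exists>g. \<forall>s\<in>{a..b}. (\<lambda>n. ?D i (R n) s) \<longlonglongrightarrow> g s \<and>
        (g has_derivative (\<lambda>h. h *\<^sub>R \<rho> (Suc i) s)) (at s within {a..b})"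
    proof (rule has_derivative_sequence)
      show "(?D i (R n) has_derivative (\<lambda>h. h *\<^sub>R ?D (Suc i) (R n) s)) (at s within {a..b})"
        if "s \<in> {a..b}" for n s
        using W26_D(2)[OF R \<open>i < 5\<close> that] by (simp add: has_vector_derivative_def)
      show "\<forall>\<^sub>F n in sequentially. \<forall>s\<in>{a..b}. \<forall>h. norm (h *\<^sub>R ?D (Suc i) (R n) s - h *\<^sub>R \<rho> (Suc i) s) \<le> e * norm h"
        if "0 < e" for e
      proof -
        have "\<forall>\<^sub>F n in sequentially. \<forall>s\<in>{a..b}. dist (?D (Suc i) (R n) s) (\<rho> (Suc i) s) < e"
          using uniform_limitD[OF ul \<open>0 < e\<close>, of "Suc i"] \<open>i < 5\<close> by simp
        then show ?thesis
        proof (eventually_elim, intro ballI allI)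
          fix n s h assume "\<forall>s\<in>{a..b}. dist (?D (Suc i) (R n) s) (\<rho> (Suc i) s) < e" "s \<in> {a..b}"
          then have "\<bar>h\<bar> * \<bar>?D (Suc i) (R n) s - \<rho> (Suc i) s\<bar> \<le> \<bar>h\<bar> * e"
            by (intro mult_left_mono) (auto simp: dist_real_def less_imp_le)
          then show "norm (h *\<^sub>R ?D (Suc i) (R n) s - h *\<^sub>R \<rho> (Suc i) s) \<le> e * norm h"
            by (simp add: abs_mult mult.commute flip: right_diff_distrib)
        qed
      qed
      show "(\<lambda>n. ?D i (R n) t) \<longlonglongrightarrow> \<rho> i t" using lim that by simp
    qed (use that in auto)
    then obtain g where g: "\<And>s. s \<in> {a..b} \<Longrightarrow> (\<lambda>n. ?D i (R n) s) \<longlonglongrightarrow> g s"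
        "\<And>s. s \<in> {a..b} \<Longrightarrow> (g has_derivative (\<lambda>h. h *\<^sub>R \<rho> (Suc i) s)) (at s within {a..b})"
      by blast
    have "\<rho> i s = g s" if "s \<in> {a..b}" for s
      using LIMSEQ_unique[OF lim g(1)] that \<open>i < 5\<close> by simp
    then show ?thesis
      using has_derivative_transform[OF that(2) _ g(2)[OF that(2)]] unfolding has_vector_derivative_def
      by blast
  qed
  have D_\<rho>: "?D i (\<rho> 0) = \<rho> i" if "i \<le> 5" for i
    using that
  proof (induction i)
    case (Suc i)
    have "?D 1 (\<rho> i) t = \<rho> (Suc i) t" for t
    proof (cases "t \<in> {a..b}")
      case True
      then show ?thesis using deriv_Icc_eq[OF \<open>a < b\<close> True der] Suc.prems by simp
    next
      case False
      then show ?thesis by (simp only: deriv_Icc_1 if_False outside[OF False])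
    qed
    then show ?case using Suc by (simp only: deriv_Icc_Suc Suc_leD)
  qed simp
  have eq: "\<rho> 5 t = f t * \<rho> 0 t" if "t \<in> {a..b}" for t
  proof -
    let ?S = "{t \<in> {a..b}. \<rho> 5 t - f t * \<rho> 0 t = 0}"
    have "continuous_on {a..b} (\<lambda>t. \<rho> 5 t - f t * \<rho> 0 t)"
      by (intro continuous_intros cont abs_cont_Icc_continuous_on[OF f(1)]) auto
    then have "closed ?S"
      by (rule continuous_closed_preimage_constant) simp
    moreover have "range x \<subseteq> ?S"
    proof safe
      fix k
      show xk: "x k \<in> {a..b}" by (rule range_subsetD[OF x(1)])
      \<comment> \<open>A fixed node is a zero only for n > k, that is, for all but finitely many
        n.\<close>
      have "\<forall>\<^sub>F n in sequentially. ?D 5 (R n) (x k) - f (x k) * ?D 0 (R n) (x k) = 0"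
        using eventually_gt_at_top[of k] by eventually_elim (use L[of k] xk in \<open>simp add: op_L_def\<close>)
      moreover have "(\<lambda>n. ?D 5 (R n) (x k) - f (x k) * ?D 0 (R n) (x k)) \<longlonglongrightarrow> \<rho> 5 (x k) - f (x k) * \<rho> 0 (x k)"
        using xk by (intro tendsto_intros lim) auto
      ultimately have "(\<lambda>n. 0) \<longlonglongrightarrow> \<rho> 5 (x k) - f (x k) * \<rho> 0 (x k)"
        by (rule Lim_transform_eventually[rotated])
      then show "\<rho> 5 (x k) - f (x k) * \<rho> 0 (x k) = 0"
        by (simp add: LIMSEQ_const_iff)
    qed
    ultimately have "closure (range x) \<subseteq> ?S" by (rule closure_minimal[rotated])
    then show ?thesis using that x(2) by auto
  qed
  have ac: "abs_cont_Icc a b (\<rho> i)" if "i \<le> 5" for i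
  proof -
    have lt: "abs_cont_Icc a b (\<rho> j)" if "j < 5" for j
      using that by (intro abs_cont_Icc_C1[OF der cont]) auto
    show ?thesis
    proof (cases "i < 5")
      \<comment> \<open>Uniform limits do not preserve absolute continuity, so the top order is read
        off from \<open>eq\<close>: a product of absolutely continuous functions.\<close>
      case False
      then have "i = 5" using that by simp
      then show ?thesis
        using abs_cont_Icc_cong[OF abs_cont_Icc_times[OF f(1) lt[of 0]] eq] by simp
    qed (rule lt)
  qed
  have "\<rho> 0 \<in> W26 a b"
  proof (rule W26_I)
    show "zero_outside a b (\<rho> 0)" using outside by (simp add: zero_outside_def)
    show "(?D i (\<rho> 0) has_vector_derivative \<rho> (Suc i) t) (at t within {a..b})" if "i < 5" "t \<in> {a..b}" for i t
      using der[OF that] D_\<rho>[of i] that by simp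
    show "abs_cont_Icc a b (?D i (\<rho> 0))" if "i \<le> 5" for i
      using ac[OF that] D_\<rho>[OF that] by simp
    have "deriv_in_L2 a b (\<lambda>t. f t * \<rho> 0 t)"
      using f der[of 0] cont[of 1]
      by (intro deriv_in_L2_times[where q' = "\<rho> 1"] \<open>a < b\<close> abs_cont_Icc_continuous_on[OF f(1)]) auto
    then show "deriv_in_L2 a b (?D 5 (\<rho> 0))"
      using D_\<rho>[of 5] eq deriv_in_L2_cong by simp
    have zero: "\<rho> i t = 0" if "i \<le> 5" "t \<in> {a..b}" "\<And>n. ?D i (R n) t = 0" for i t
      using lim[OF that(1,2)] that(3) by (simp add: LIMSEQ_const_iff)
    show "\<rho> 0 a = 0" "?D 1 (\<rho> 0) a = 0" "?D 2 (\<rho> 0) a = 0" "\<rho> 0 b = 0" "?D 1 (\<rho> 0) b = 0"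
      unfolding D_\<rho>[of 1, simplified] D_\<rho>[of 2, simplified]
      using \<open>a < b\<close> W26_D(5-9)[OF R] D_\<rho>[of 1] D_\<rho>[of 2] by (auto intro!: zero)
  qed
  moreover have "op_L a b f (\<rho> 0) = op_L a b f (\<lambda>t. 0)"
    using eq D_\<rho>[of 5] deriv_Icc_zero[OF \<open>a < b\<close>, of 5] by (auto simp: op_L_def fun_eq_iff)
  ultimately have \<rho>0: "\<rho> 0 = (\<lambda>t. 0)"
    using inj_onD[OF inj] W26_zero[OF \<open>a < b\<close>] by blast
  have \<rho>_zero: "\<rho> i t = 0" if "i \<le> 5" for i t
    using fun_cong[OF D_\<rho>[OF that, unfolded \<rho>0 deriv_Icc_zero[OF \<open>a < b\<close>]], of t] by simp
  have lim0: "(\<lambda>n. ?D i (R n) t) \<longlonglongrightarrow> 0" if "i \<le> 5" "t \<in> {a..b}" for i t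
    using lim[OF that] \<rho>_zero[OF that(1)] by simp
  have "(\<lambda>n. LINT t:{a..b}|lebesgue. (?D 6 (R n) t)\<^sup>2) \<longlonglongrightarrow> 0"
    unfolding LIMSEQ_iff
  proof (intro allI impI)
    fix \<epsilon> :: real assume "0 < \<epsilon>"
    then obtain N where N: "\<And>m n. N \<le> m \<Longrightarrow> m \<le> n \<Longrightarrow>
        inner_W26 a b (\<lambda>t. R m t - R n t) (\<lambda>t. R m t - R n t) < \<epsilon> / 2"
      using Cauchy[of "\<epsilon> / 2"] by auto
    have D6: "?D 1 (?D 5 v) = ?D 6 v" for v using deriv_Icc_Suc[of a b 5 v] by simp
    have "norm ((LINT t:{a..b}|lebesgue. (?D 6 (R m) t)\<^sup>2) - 0) < \<epsilon>" if "N \<le> m" for m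
    proof -
      have "slope_energy a b (?D 5 (R m)) k \<le> \<epsilon> / 2" if "0 < k" for k
      \<comment> \<open>The grid and \<open>m\<close> are fixed while n grows. The energy of
        \<open>?D 5 (R m) - ?D 5 (R n)\<close> involves finitely many grid points, so the limit 0 of
        \<open>?D 5 (R n)\<close> at these points removes the second term, and the Cauchy bound
        survives.\<close>
      proof (rule LIMSEQ_le_const2)
        have "grid_point a b k j \<in> {a..b}" if "j \<le> k" for j
          using grid_point_in_Icc[of a b k j] that \<open>0 < k\<close> \<open>a < b\<close> by simp
        then have "(\<lambda>n. slope_energy a b (\<lambda>t. ?D 5 (R m) t - ?D 5 (R n) t) k)
            \<longlonglongrightarrow> slope_energy a b (\<lambda>t. ?D 5 (R m) t - 0) k"
          unfolding slope_energy_def using \<open>a < b\<close> \<open>0 < k\<close> by (intro tendsto_intros lim0) auto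
        then show "(\<lambda>n. slope_energy a b (\<lambda>t. ?D 5 (R m) t - ?D 5 (R n) t) k)
            \<longlonglongrightarrow> slope_energy a b (?D 5 (R m)) k" by simp
        have "slope_energy a b (\<lambda>t. ?D 5 (R m) t - ?D 5 (R n) t) k \<le> \<epsilon> / 2" if "m \<le> n" for n
        proof -
          have "slope_energy a b (?D 5 (\<lambda>t. R m t - R n t)) k
              \<le> (LINT t:{a..b}|lebesgue. (?D 6 (\<lambda>t. R m t - R n t) t)\<^sup>2)"
            using slope_energy_le[OF \<open>a < b\<close> W26_D(3)[OF diff order_refl] W26_D(4)[OF diff] \<open>0 < k\<close>]
            by (simp only: D6)
          also have "\<dots> \<le> inner_W26 a b (\<lambda>t. R m t - R n t) (\<lambda>t. R m t - R n t)"
            by (rule integral_deriv6_le_inner_W26[OF \<open>a < b\<close> diff])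
          also have "\<dots> \<le> \<epsilon> / 2"
            using N[OF \<open>N \<le> m\<close> that] by simp
          finally show ?thesis using D_diff[of 5] by simp
        qed
        then show "\<exists>n0. \<forall>n\<ge>n0. slope_energy a b (\<lambda>t. ?D 5 (R m) t - ?D 5 (R n) t) k \<le> \<epsilon> / 2"
          by blast
      qed
      then have "(LINT t:{a..b}|lebesgue. (?D 6 (R m) t)\<^sup>2) \<le> \<epsilon> / 2"
        using deriv_L2_le_slope_energy[OF \<open>a < b\<close> W26_D(4)[OF R], of "\<epsilon> / 2" m] \<open>0 < \<epsilon>\<close>
        by (simp only: D6)
      moreover have "0 \<le> (LINT t:{a..b}|lebesgue. (?D 6 (R m) t)\<^sup>2)"
        unfolding set_lebesgue_integral_def by (intro integral_nonneg_AE) auto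
      ultimately show ?thesis using \<open>0 < \<epsilon>\<close> by simp
    qed
    then show "\<exists>n0. \<forall>n\<ge>n0. norm ((LINT t:{a..b}|lebesgue. (?D 6 (R n) t)\<^sup>2) - 0) < \<epsilon>"
      by blast
  qed
  moreover have "(\<lambda>n. \<Sum>i\<le>5. (?D i (R n) a)\<^sup>2) \<longlonglongrightarrow> (\<Sum>i\<le>(5::nat). 0\<^sup>2)"
    using \<open>a < b\<close> by (intro tendsto_intros lim0) auto
  ultimately have "(\<lambda>n. (\<Sum>i\<le>5. (?D i (R n) a)\<^sup>2) + (LINT t:{a..b}|lebesgue. (?D 6 (R n) t)\<^sup>2))
      \<longlonglongrightarrow> (\<Sum>i\<le>(5::nat). 0\<^sup>2) + 0"
    by (rule tendsto_add[rotated])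
  then show ?thesis by (simp add: inner_W26_def power2_eq_square)
qed

section \<open>The expansion of the solution\<close>

theorem theorem3p2:
  fixes a b :: real
    and f g u :: "real \<Rightarrow> real"
    and T :: "real \<Rightarrow> real \<Rightarrow> real"
    and Lstar :: "(real \<Rightarrow> real) \<Rightarrow> (real \<Rightarrow> real)"
    and x :: "nat \<Rightarrow> real"
    and \<Psi> \<Psi>bar :: "nat \<Rightarrow> real \<Rightarrow> real"
    and \<beta> :: "nat \<Rightarrow> nat \<Rightarrow> real"
  assumes "a < b"
    and "abs_cont_Icc a b f" and "deriv_in_L2 a b f"
    and "continuous_on {a..b} g"
    and L_invertible: "bij_betw (op_L a b f) (W26 a b) (W21 a b)"
    and T: "is_reproducing_kernel (W21 a b) (inner_W21 a b) {a..b} T"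
    and Lstar: "is_adjoint (W26 a b) (inner_W26 a b) (W21 a b) (inner_W21 a b) (op_L a b f) Lstar"
    and "inj x" and "range x \<subseteq> {a..b}" and dense: "{a..b} \<subseteq> closure (range x)"
    and \<Psi>: "\<And>i. \<Psi> i = Lstar (T (x i))"
    and \<Psi>bar: "\<Psi>bar = gram_schmidt (inner_W26 a b) \<Psi>"
    and \<beta>: "\<And>i t. \<Psi>bar i t = (\<Sum>k\<le>i. \<beta> i k * \<Psi> k t)" and "\<And>i. \<beta> i i > 0"
    and u: "u \<in> W26 a b"
    and u_solves: "\<And>t. t \<in> {a..b} \<Longrightarrow> deriv_Icc a b 5 u t = f t * u t + g t"
  shows "(\<lambda>n. norm_W26 a b (\<lambda>t. u t - (\<Sum>i<n. (\<Sum>k\<le>i. \<beta> i k * g (x k)) * \<Psi>bar i t))) \<longlonglongrightarrow> 0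
    \<and> (\<forall>t\<in>{a..b}. (\<lambda>i. \<Sum>k\<le>i. \<beta> i k * g (x k) * \<Psi>bar i t) sums u t)"
proof -
  interpret W: semi_inner_product "W26 a b" "inner_W26 a b"
    by (rule semi_inner_product_W26[OF \<open>a < b\<close>])
  have x: "x k \<in> {a..b}" for k by (rule range_subsetD[OF \<open>range x \<subseteq> {a..b}\<close>])
  have TW: "T (x k) \<in> W21 a b" for k
    using T x by (simp add: is_reproducing_kernel_def)
  have \<Psi>_mem: "\<Psi> k \<in> W26 a b" for k
    using Lstar TW by (simp add: is_adjoint_def \<Psi>)
  \<comment> \<open>The adjoint moves the pairing with \<open>Lstar (T (x k))\<close> to
    \<open>W21\<close>, where the reproducing property evaluates at the node.\<close>
  have eval: "inner_W26 a b v (\<Psi> k) = op_L a b f v (x k)" if v: "v \<in> W26 a b" for v k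
  proof -
    have "op_L a b f v \<in> W21 a b" using bij_betwE[OF L_invertible] v by blast
    then have "inner_W21 a b (op_L a b f v) (T (x k)) = op_L a b f v (x k)"
      using T x by (simp add: is_reproducing_kernel_def)
    then show ?thesis using Lstar TW v by (simp add: is_adjoint_def \<Psi>)
  qed
  have coeff: "inner_W26 a b u (\<Psi>bar i) = (\<Sum>k\<le>i. \<beta> i k * g (x k))" for i
  proof -
    have "\<Psi>bar i = (\<lambda>t. \<Sum>k\<le>i. \<beta> i k * \<Psi> k t)" using \<beta> by (rule ext)
    then have "inner_W26 a b u (\<Psi>bar i) = (\<Sum>k\<le>i. \<beta> i k * inner_W26 a b u (\<Psi> k))"
      using W.sum_right[of "{..i}" \<Psi> u "\<beta> i"] \<Psi>_mem u by simp
    \<comment> \<open>Nodes lie in \<open>{a..b}\<close>, so \<open>op_L\<close> takes its first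
      branch and the differential equation applies.\<close>
    moreover have "inner_W26 a b u (\<Psi> k) = g (x k)" for k
      using eval[OF u] u_solves[OF x] x[of k] by (simp add: op_L_def)
    ultimately show ?thesis by simp
  qed
  define R where "R = W.fourier_remainder \<Psi> u"
  have R_eq: "R n = (\<lambda>t. u t - (\<Sum>i<n. (\<Sum>k\<le>i. \<beta> i k * g (x k)) * \<Psi>bar i t))" for n
    unfolding R_def W.fourier_remainder_def coeff[symmetric] \<Psi>bar ..
  have R: "R n \<in> W26 a b" for n
    unfolding R_def by (rule W.fourier_remainder_mem[OF \<Psi>_mem u])
  have "(\<lambda>n. inner_W26 a b (R n) (R n)) \<longlonglongrightarrow> 0"
  proof (rule W26_Cauchy_limit_zero[OF \<open>a < b\<close> \<open>abs_cont_Icc a b f\<close> \<open>deriv_in_L2 a b f\<close>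
        bij_betw_imp_inj_on[OF L_invertible] R _ \<open>range x \<subseteq> {a..b}\<close> dense])
    show "\<exists>N. \<forall>m\<ge>N. \<forall>n\<ge>m. inner_W26 a b (\<lambda>t. R m t - R n t) (\<lambda>t. R m t - R n t) < \<epsilon>"
      if "0 < \<epsilon>" for \<epsilon>
      unfolding R_def by (rule W.fourier_remainder_Cauchy[OF \<Psi>_mem u that])
    show "op_L a b f (R n) (x k) = 0" if "k < n" for k n
      using W.fourier_remainder_orthogonal_generator[of \<Psi>, OF \<Psi>_mem u that] eval[OF R, of n k]
      by (simp add: R_def)
  qed
  then have "(\<lambda>n. sqrt (inner_W26 a b (R n) (R n))) \<longlonglongrightarrow> sqrt 0"
    by (rule tendsto_real_sqrt)
  then have norm: "(\<lambda>n. norm_W26 a b (R n)) \<longlonglongrightarrow> 0"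
    by (simp add: norm_W26_def)
  moreover have "(\<lambda>i. \<Sum>k\<le>i. \<beta> i k * g (x k) * \<Psi>bar i t) sums u t" if t: "t \<in> {a..b}" for t
  proof -
    \<comment> \<open>Order zero of the sup bound: point evaluation is bounded on
      \<open>W26\<close>, so norm convergence gives the pointwise sum.\<close>
    obtain C where C: "\<And>v. v \<in> W26 a b \<Longrightarrow> \<bar>v t\<bar> \<le> C * norm_W26 a b v"
      using W26_sup_bound[OF \<open>a < b\<close>, of 0] t unfolding deriv_Icc_0 by blast
    have "(\<lambda>n. C * norm_W26 a b (R n)) \<longlonglongrightarrow> 0"
      using tendsto_mult_right_zero[OF norm] .
    then have "(\<lambda>n. R n t) \<longlonglongrightarrow> 0"
      by (rule Lim_null_comparison[rotated]) (simp add: C R)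
    then have "(\<lambda>n. u t - R n t) \<longlonglongrightarrow> u t - 0"
      by (intro tendsto_intros)
    then show ?thesis
      by (simp add: sums_def R_eq sum_distrib_right)
  qed
  ultimately show ?thesis unfolding R_eq by blast
qed

end
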